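(* Let $\Omega\subseteq\mathbb{R}^d$ be compact, $k\in\mathbb{N}_0$, and let $|\cdot|_*$ be a norm on $\mathbb{R}^d$. Suppose that $\{x_n\}_{n\in I}\subseteq\mathbb{R}^d$ ($I$ countable) and $\mu_{n,\alpha}>0$, $n\in I$, $|\alpha|_1\le k$, are such that $$A\|f\|^2\le\sum_{n\in I}\sum_{|\alpha|_1\le k}\mu_{n,\alpha}|D^\alpha f(x_n)|^2\le B\|f\|^2,\qquad\forall f\in\mathrm{B}(\Omega),$$ holds with constants $A,B>0$. Let $\{\tilde x_n\}_{n\in I}\subseteq\mathbb{R}^d$ be such that $$\epsilon=\sup_{n\in I}|\tilde x_n-x_n|_*<\frac{\log(1+\sqrt{A/B})}{m_\Omega b}.$$ Then $$\tilde A\|f\|^2\le\sum_{n\in I}\sum_{|\alpha|_1\le k}\mu_{n,\alpha}|D^\alpha f(\tilde x_n)|^2\le\tilde B\|f\|^2,\qquad\forall f\in\mathrm{B}(\Omega),$$ where $$\tilde A\ge\left(\sqrt A-\sqrt B\left(\exp(m_\Omega b\epsilon)-1\right)\right)^2,\qquad\tilde B\le B\exp(2m_\Omega b\epsilon).$$ That is, if the set $\{\sqrt{\mu_{n,\alpha}}D^\alpha\Phi_\Omega(\cdot-x_n):n\in I,|\alpha|_1\le k\}$ forms a frame for $\mathrm{B}(\Omega)$ with bounds $A$ and $B$, then the set $\{\sqrt{\mu_{n,\alpha}}D^\alpha\Phi_\Omega(\cdot-\tilde x_n):n\in I,|\alpha|_1\le k\}$ forms a frame with bounds $\tilde A$ and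 $\tilde B$.
   Context: $\|\cdot\|$ is the norm of $L^2(\mathbb{R}^d)$; $\hat f(\omega)=\int_{\mathbb{R}^d}f(x)e^{-i\omega\cdot x}\,\mathrm{d}x$; $\mathrm{B}(\Omega)=\{f\in L^2(\mathbb{R}^d):\operatorname{supp}(\hat f)\subseteq\Omega\}$ (smooth representatives are used). For $\alpha\in\mathbb{N}_0^d$, $|\alpha|_1=\alpha_1+\dots+\alpha_d$ and $D^\alpha$ is the corresponding partial derivative. $|\cdot|_2$ is the Euclidean norm; $b>0$ is the smallest constant with $|x|_2\le b|x|_*$ for all $x\in\mathbb{R}^d$; $m_\Omega=\sup_{\omega\in\Omega}|\omega|_2$; $\Phi_\Omega(x)=\frac{1}{(2\pi)^d}\int_\Omega e^{i\omega\cdot x}\,\mathrm{d}\omega$. A family $\{\phi_i\}$ in a Hilbert space is a frame with bounds $A,B>0$ if $A\|f\|^2\le\sum_i|\langle f,\phi_i\rangle|^2\le B\|f\|^2$ for all $f$. *)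

theory Defs
  imports "HOL-Analysis.Analysis"
begin

section \<open>Square-integrable functions and the Fourier-Plancherel transform\<close>

definition L2 :: "(real^'d \<Rightarrow> complex) set" where
  "L2 = {f. f \<in> borel_measurable lborel \<and> integrable lborel (\<lambda>x. (cmod (f x))\<^sup>2)}"

definition L2_norm :: "(real^'d \<Rightarrow> complex) \<Rightarrow> real" where
  "L2_norm f = sqrt (LINT x|lborel. (cmod (f x))\<^sup>2)"

definition L2_inner :: "(real^'d \<Rightarrow> complex) \<Rightarrow> (real^'d \<Rightarrow> complex) \<Rightarrow> complex" where
  "L2_inner f g = (LINT x|lborel. f x * cnj (g x))"

definition fourier_trunc :: "(real^'d \<Rightarrow> complex) \<Rightarrow> real \<Rightarrow> real^'d \<Rightarrow> complex" where
  "fourier_trunc f R \<omega> =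
     (LINT x:cball 0 R|lborel. f x * exp (- (\<i> * of_real (\<omega> \<bullet> x))))"

text \<open>
  An element of \<open>L2\<close> need not be integrable, so its Fourier transform is the limit in the mean of
  the truncated Fourier integrals. It is determined up to null sets, hence a relation. The squared
  distance is a nonnegative Lebesgue integral, so convergence cannot hold vacuously.
\<close>
definition has_fourier_transform ::
    "(real^'d \<Rightarrow> complex) \<Rightarrow> (real^'d \<Rightarrow> complex) \<Rightarrow> bool" where
  "has_fourier_transform f g \<longleftrightarrow> g \<in> L2 \<and>
     ((\<lambda>R. \<integral>\<^sup>+ \<omega>. ennreal ((cmod (fourier_trunc f R \<omega> - g \<omega>))\<^sup>2) \<partial>lborel) \<longlongrightarrow> 0) at_top"

text \<open>
  The support of an almost-everywhere class: the complement of the largest open set on which the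
  function vanishes almost everywhere.
\<close>
definition ess_support :: "(real^'d \<Rightarrow> complex) \<Rightarrow> (real^'d) set" where
  "ess_support g = - \<Union>{U. open U \<and> (AE \<omega> in lborel. \<omega> \<in> U \<longrightarrow> g \<omega> = 0)}"

section \<open>Partial derivatives\<close>

definition partial_diff :: "'d::finite \<Rightarrow> (real^'d \<Rightarrow> complex) \<Rightarrow> real^'d \<Rightarrow> complex" where
  "partial_diff i f x = vector_derivative (\<lambda>t. f (x + t *\<^sub>R axis i 1)) (at 0)"

definition smooth :: "(real^'d::finite \<Rightarrow> complex) \<Rightarrow> bool" where
  "smooth f \<longleftrightarrow> (\<forall>is :: 'd list. foldr partial_diff is f differentiable_on UNIV)"

text \<open>
  The coordinates are processed in some fixed order; on smooth functions, the only ones to which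
  this operator is applied below, partial derivatives commute and the order is immaterial.
\<close>
definition multi_diff :: "nat^'d::finite \<Rightarrow> (real^'d \<Rightarrow> complex) \<Rightarrow> real^'d \<Rightarrow> complex" where
  "multi_diff \<alpha> f =
     foldr (\<lambda>i. partial_diff i ^^ (\<alpha> $ i)) (SOME is. distinct is \<and> set is = UNIV) f"

definition multi_indices :: "nat \<Rightarrow> (nat^'d::finite) set" where
  "multi_indices k = {\<alpha>. (\<Sum>i\<in>UNIV. \<alpha> $ i) \<le> k}"

lemma finite_multi_indices: "finite (multi_indices k :: (nat^'d::finite) set)"
proof -
  have "multi_indices k \<subseteq> vec_lambda ` (PiE (UNIV :: 'd set) (\<lambda>_. {..k}))"
  proof
    fix \<alpha> :: "nat^'d" assume \<alpha>: "\<alpha> \<in> multi_indices k"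
    have "\<alpha> $ i \<le> k" for i
      using \<alpha> member_le_sum[of i UNIV "\<lambda>i. \<alpha> $ i"] by (auto simp: multi_indices_def)
    then have "vec_nth \<alpha> \<in> PiE UNIV (\<lambda>_. {..k})" by auto
    then show "\<alpha> \<in> vec_lambda ` (PiE (UNIV :: 'd set) (\<lambda>_. {..k}))"
      by (metis image_eqI vec_nth_inverse)
  qed
  then show ?thesis by (rule finite_subset) (intro finite_imageI finite_PiE; simp)
qed

section \<open>Bandlimited functions and frames\<close>

text \<open>
  Elements are smooth functions rather than almost-everywhere classes, so that point evaluations
  make sense. For compact \<open>\<Omega>\<close> every class with spectrum in \<open>\<Omega>\<close> has exactly one smooth representative.
\<close>
definition bandlimited :: "(real^'d) set \<Rightarrow> (real^'d \<Rightarrow> complex) set" where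
  "bandlimited \<Omega> =
     {f \<in> L2. smooth f \<and> (\<exists>g. has_fourier_transform f g \<and> ess_support g \<subseteq> \<Omega>)}"

definition Phi :: "(real^'d) set \<Rightarrow> real^'d \<Rightarrow> complex" where
  "Phi \<Omega> x = (LINT \<omega>:\<Omega>|lborel. exp (\<i> * of_real (\<omega> \<bullet> x))) / of_real ((2 * pi) ^ CARD('d))"

text \<open>
  Sums over possibly infinite index sets are taken in \<open>ennreal\<close>, where they always exist; the upper
  bounds below therefore include convergence.
\<close>
definition is_frame :: "(real^'d \<Rightarrow> complex) set \<Rightarrow> 'j set \<Rightarrow> ('j \<Rightarrow> real^'d \<Rightarrow> complex)
    \<Rightarrow> real \<Rightarrow> real \<Rightarrow> bool" where
  "is_frame H J \<phi> A B \<longleftrightarrow> 0 < A \<and> 0 < B \<and> (\<forall>j\<in>J. \<phi> j \<in> H) \<and>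
     (\<forall>f\<in>H.
        ennreal (A * (L2_norm f)\<^sup>2) \<le> (\<Sum>\<^sub>\<infinity>j\<in>J. ennreal ((cmod (L2_inner f (\<phi> j)))\<^sup>2)) \<and>
        (\<Sum>\<^sub>\<infinity>j\<in>J. ennreal ((cmod (L2_inner f (\<phi> j)))\<^sup>2)) \<le> ennreal (B * (L2_norm f)\<^sup>2))"

definition sampling_bounds :: "(real^'d::finite) set \<Rightarrow> nat \<Rightarrow> 'n set \<Rightarrow> ('n \<Rightarrow> nat^'d \<Rightarrow> real)
    \<Rightarrow> ('n \<Rightarrow> real^'d) \<Rightarrow> real \<Rightarrow> real \<Rightarrow> bool" where
  "sampling_bounds \<Omega> k I \<mu> x A B \<longleftrightarrow> 0 < A \<and> 0 < B \<and>
     (\<forall>f\<in>bandlimited \<Omega>.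
        ennreal (A * (L2_norm f)\<^sup>2)
          \<le> (\<Sum>\<^sub>\<infinity>n\<in>I. \<Sum>\<alpha>\<in>multi_indices k. ennreal (\<mu> n \<alpha> * (cmod (multi_diff \<alpha> f (x n)))\<^sup>2)) \<and>
        (\<Sum>\<^sub>\<infinity>n\<in>I. \<Sum>\<alpha>\<in>multi_indices k. ennreal (\<mu> n \<alpha> * (cmod (multi_diff \<alpha> f (x n)))\<^sup>2))
          \<le> ennreal (B * (L2_norm f)\<^sup>2))"

text \<open>The family \<open>\<surd>\<mu>\<^bsub>n,\<alpha>\<^esub> D\<^sup>\<alpha> \<Phi>\<^sub>\<Omega>(\<cdot> - x\<^sub>n)\<close>, indexed by the pairs \<open>(n, \<alpha>)\<close>.\<close>
definition frame_family :: "(real^'d::finite) set \<Rightarrow> ('n \<Rightarrow> nat^'d \<Rightarrow> real) \<Rightarrow> ('n \<Rightarrow> real^'d)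
    \<Rightarrow> 'n \<times> (nat^'d) \<Rightarrow> real^'d \<Rightarrow> complex" where
  "frame_family \<Omega> \<mu> x = (\<lambda>(n, \<alpha>) y.
     of_real (sqrt (\<mu> n \<alpha>)) * multi_diff \<alpha> (\<lambda>z. Phi \<Omega> (z - x n)) y)"

section \<open>Norms and constants\<close>

definition is_norm :: "(real^'d \<Rightarrow> real) \<Rightarrow> bool" where
  "is_norm N \<longleftrightarrow> (\<forall>x. 0 \<le> N x) \<and> (\<forall>x. N x = 0 \<longleftrightarrow> x = 0) \<and>
     (\<forall>c x. N (c *\<^sub>R x) = \<bar>c\<bar> * N x) \<and> (\<forall>x y. N (x + y) \<le> N x + N y)"

definition norm_const :: "(real^'d \<Rightarrow> real) \<Rightarrow> real" where
  "norm_const N = (LEAST b. 0 < b \<and> (\<forall>x. norm x \<le> b * N x))"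

text \<open>The least constant is attained, so \<open>LEAST\<close> is meaningful.\<close>
lemma norm_const:
  fixes N :: "real^'d \<Rightarrow> real"
  assumes "is_norm N"
  shows "0 < norm_const N" "norm x \<le> norm_const N * N x"
    "(\<And>y. norm y \<le> c * N y) \<Longrightarrow> norm_const N \<le> c"
proof -
  have N: "0 \<le> N x" "N x = 0 \<longleftrightarrow> x = 0" "N (a *\<^sub>R x) = \<bar>a\<bar> * N x" "N (x + y) \<le> N x + N y" for a x y
    using assms by (auto simp: is_norm_def)
  have "convex_on UNIV N"
  proof (rule convex_onI)
    fix t :: real and x y assume "0 < t" "t < 1"
    then show "N ((1 - t) *\<^sub>R x + t *\<^sub>R y) \<le> (1 - t) * N x + t * N y"
      using N(4)[of "(1 - t) *\<^sub>R x" "t *\<^sub>R y"] by (simp add: N(3))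
  qed auto
  then have cont: "continuous_on UNIV N" by (intro convex_on_continuous) auto
  have "norm (axis undefined 1 :: real^'d) = 1" by (simp add: norm_axis_1)
  then have "sphere (0 :: real^'d) 1 \<noteq> {}" by (metis empty_iff mem_sphere_0)
  then obtain x0 where x0: "norm x0 = 1" "\<And>y. norm y = 1 \<Longrightarrow> N x0 \<le> N y"
    using continuous_attains_inf[of "sphere (0 :: real^'d) 1" N] continuous_on_subset[OF cont]
    by (metis compact_sphere mem_sphere_0 subset_UNIV)
  have pos: "0 < N x0" using N(1,2)[of x0] x0(1) by (metis norm_zero order_le_less zero_neq_one)
  have le: "norm x \<le> 1 / N x0 * N x" for x
  proof (cases "x = 0")
    case False
    then have "N x0 \<le> N ((1 / norm x) *\<^sub>R x)" by (intro x0) auto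
    with False pos show ?thesis by (simp add: N(3) field_simps)
  qed (use N(2)[of 0] in auto)
  have least: "1 / N x0 \<le> b" if "\<And>x. norm x \<le> b * N x" for b
    using that[of x0] x0(1) pos by (simp add: field_simps)
  have eq: "norm_const N = 1 / N x0"
    unfolding norm_const_def using pos le least by (intro Least_equality) auto
  show "0 < norm_const N" "norm x \<le> norm_const N * N x" using pos le by (auto simp: eq)
  show "norm_const N \<le> c" if "\<And>y. norm y \<le> c * N y" using least that by (simp add: eq)
qed

text \<open>
  The supremum of norms over the empty set is \<open>0\<close> (suprema of subsets of \<open>[0, \<infinity>]\<close>), whereas
  \<^term>\<open>Sup {} :: real\<close> is unspecified.
\<close>
definition band_radius :: "(real^'d) set \<Rightarrow> real" where
  "band_radius \<Omega> = (if \<Omega> = {} then 0 else (SUP \<omega>\<in>\<Omega>. norm \<omega>))"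

end

theory Submission
  imports Defs "HOL-Probability.Characteristic_Functions"
begin

text \<open>
  A function \<open>f\<close> with spectrum in the compact set \<open>\<Omega>\<close> is entire, so \<open>D\<^sup>\<alpha> f (x'\<^sub>n) - D\<^sup>\<alpha> f (x\<^sub>n)\<close> is the sum over
  \<open>j \<ge> 1\<close> of the Taylor terms at \<open>x\<^sub>n\<close> in the direction \<open>h\<^sub>n = x'\<^sub>n - x\<^sub>n\<close>. The term of degree \<open>j\<close> is
  \<open>1/j!\<close> times the sum, over the \<open>d\<^sup>j\<close> tuples \<open>p\<close> of coordinates, of \<open>h\<^sub>n(p\<^sub>1) \<cdots> h\<^sub>n(p\<^sub>j) D\<^sup>\<alpha> f\<^sub>p (x\<^sub>n)\<close>,
  where \<open>f\<^sub>p\<close> is the derivative of \<open>f\<close> along the coordinates of \<open>p\<close>. The functions \<open>f\<^sub>p\<close> do not depend on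
  \<open>n\<close> and are bandlimited again, so the upper sampling bound \<open>B\<close> applies to each of them. The
  Cauchy-Schwarz inequality over \<open>p\<close> and \<open>\<Sum>\<^sub>p \<parallel>f\<^sub>p\<parallel>\<^sup>2 \<le> m\<^sup>2\<^sup>j \<parallel>f\<parallel>\<^sup>2\<close> (a Bernstein inequality, where \<open>m\<close> is
  the radius of the band, lemma \<open>Bernstein_tuples\<close>) bound the weighted \<open>\<ell>\<^sup>2\<close> norm over \<open>(n, \<alpha>)\<close> of the
  terms of degree \<open>j\<close> by \<open>\<surd>B (m b \<epsilon>)\<^sup>j / j! \<parallel>f\<parallel>\<close>. Minkowski's inequality and the exponential series
  give \<open>\<surd>B (exp (m b \<epsilon>) - 1) \<parallel>f\<parallel>\<close> for the difference of the two sequences of samples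
  (lemma \<open>sample_perturbation\<close>), and the triangle inequality in \<open>\<ell>\<^sup>2\<close> turns this into both new bounds
  (theorem \<open>sampling_bounds_perturbation\<close>).

  All this is done on the Fourier side. The bandlimited functions are exactly the integrals
  \<open>f(x) = \<integral> g(\<omega>) e\<^sup>i\<^sup>\<omega>\<^sup>\<cdot>\<^sup>x d\<omega>\<close> with \<open>g\<close> square-integrable and zero outside \<open>\<Omega>\<close> (theorem
  \<open>bandlimited_eq\<close>); differentiating \<open>f\<close> multiplies \<open>g\<close> by a monomial, and norms and inner products
  are computed by the Plancherel theorem. The latter is proved for functions that are both integrable
  and square-integrable: damp the inner product of two Fourier integrals by a wide Gaussian, use
  Fubini's theorem to rewrite it as an average of inner products of translates over a narrow Gaussian,
  and pass to the limit by continuity of translations in the mean. The Fourier transform of a general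
  square-integrable function is only used through its truncations, and there the Plancherel theorem
  for integrable functions suffices.

  The statement on frames is the statement on sampling in another form: the inner product of \<open>f\<close> with
  \<open>D\<^sup>\<alpha> \<Phi>\<^sub>\<Omega>(\<cdot> - x\<^sub>n)\<close> is \<open>(-1)\<^bsup>|\<alpha>|\<^esup> D\<^sup>\<alpha> f (x\<^sub>n)\<close>, because \<open>D\<^sup>\<alpha> \<Phi>\<^sub>\<Omega>(\<cdot> - x\<^sub>n)\<close> has the spectrum
  \<open>(2\<pi>)\<^bsup>-d\<^esup> (i\<omega>)\<^sup>\<alpha> e\<^bsup>-i\<omega>\<cdot>x\<^sub>n\<^esup>\<close> on \<open>\<Omega>\<close> (lemma \<open>is_frame_iff_sampling_bounds\<close>).
\<close>

section \<open>Square-integrable functions\<close>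

lemma cnj_measurable [measurable]: "cnj \<in> borel_measurable borel"
  by (intro borel_measurable_continuous_onI continuous_intros)

lemma L2_norm_power2: "(L2_norm f)\<^sup>2 = (LINT x|lborel. (cmod (f x))\<^sup>2)"
  by (simp add: L2_norm_def)

lemma L2_norm_nonneg: "0 \<le> L2_norm f"
  by (simp add: L2_norm_def)

lemma L2_D:
  assumes "f \<in> L2"
  shows "f \<in> borel_measurable borel" "integrable lborel (\<lambda>x. (cmod (f x))\<^sup>2)"
  using assms by (auto simp: L2_def)

lemma L2_I:
  assumes "f \<in> borel_measurable borel" "integrable lborel h" "\<And>x. (cmod (f x))\<^sup>2 \<le> h x"
  shows "f \<in> L2"
proof -
  have [measurable]: "f \<in> borel_measurable borel" by fact
  have "integrable lborel (\<lambda>x. (cmod (f x))\<^sup>2)"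
    by (rule Bochner_Integration.integrable_bound[OF assms(2)])
      (auto intro!: AE_I2 order_trans[OF assms(3) abs_ge_self])
  then show ?thesis by (simp add: L2_def)
qed

lemma L2_bounded_mult:
  assumes u: "u \<in> L2" and m: "m \<in> borel_measurable borel" "\<And>x. u x \<noteq> 0 \<Longrightarrow> cmod (m x) \<le> C"
  shows "(\<lambda>x. m x * u x) \<in> L2"
proof (rule L2_I)
  note [measurable] = L2_D(1)[OF u] m(1)
  show "(\<lambda>x. m x * u x) \<in> borel_measurable borel" by measurable
  show "integrable lborel (\<lambda>x. C\<^sup>2 * (cmod (u x))\<^sup>2)"
    using L2_D(2)[OF u] by simp
  show "(cmod (m x * u x))\<^sup>2 \<le> C\<^sup>2 * (cmod (u x))\<^sup>2" for x
  proof (cases "u x = 0")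
    case False
    then show ?thesis using m(2)[of x]
      by (auto simp: norm_mult power_mult_distrib intro!: mult_right_mono power_mono)
  qed auto
qed

lemma L2_cmult: "u \<in> L2 \<Longrightarrow> (\<lambda>x. c * u x) \<in> L2"
  by (rule L2_bounded_mult[where C="cmod c"]) auto

lemma cmod_add_power2_le: "(cmod (a + b))\<^sup>2 \<le> 2 * (cmod a)\<^sup>2 + 2 * (cmod b)\<^sup>2"
proof -
  have "(cmod (a + b))\<^sup>2 \<le> (cmod a + cmod b)\<^sup>2"
    by (intro power_mono norm_triangle_ineq) auto
  also have "\<dots> \<le> 2 * (cmod a)\<^sup>2 + 2 * (cmod b)\<^sup>2"
    using zero_le_power2[of "cmod a - cmod b"] by (simp add: power2_eq_square algebra_simps)
  finally show ?thesis .
qed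

lemma L2_add:
  assumes u: "u \<in> L2" and v: "v \<in> L2"
  shows "(\<lambda>x. u x + v x) \<in> L2"
proof (rule L2_I)
  note [measurable] = L2_D(1)[OF u] L2_D(1)[OF v]
  show "(\<lambda>x. u x + v x) \<in> borel_measurable borel" by measurable
  show "integrable lborel (\<lambda>x. 2 * (cmod (u x))\<^sup>2 + 2 * (cmod (v x))\<^sup>2)"
    using L2_D(2)[OF u] L2_D(2)[OF v] by simp
qed (rule cmod_add_power2_le)

lemma L2_diff: "u \<in> L2 \<Longrightarrow> v \<in> L2 \<Longrightarrow> (\<lambda>x. u x - v x) \<in> L2"
  using L2_add[of u "\<lambda>x. - 1 * v x"] L2_cmult[of v "- 1"] by simp

lemma mult_le_sum_power2: "a * b \<le> a\<^sup>2 + b\<^sup>2" for a b :: real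
  using zero_le_power2[of "a - b"] zero_le_power2[of a] zero_le_power2[of b]
  unfolding power2_diff by linarith

lemma L2_mult_integrable_real:
  assumes u: "u \<in> L2" and v: "v \<in> L2"
  shows "integrable lborel (\<lambda>x. cmod (u x) * cmod (v x))"
proof (rule Bochner_Integration.integrable_bound)
  note [measurable] = L2_D(1)[OF u] L2_D(1)[OF v]
  show "integrable lborel (\<lambda>x. (cmod (u x))\<^sup>2 + (cmod (v x))\<^sup>2)"
    using L2_D(2)[OF u] L2_D(2)[OF v] by simp
  show "(\<lambda>x. cmod (u x) * cmod (v x)) \<in> borel_measurable lborel" by measurable
  show "AE x in lborel. norm (cmod (u x) * cmod (v x)) \<le> norm ((cmod (u x))\<^sup>2 + (cmod (v x))\<^sup>2)"
    by (auto simp: norm_mult mult_le_sum_power2)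
qed

lemma L2_mult_integrable:
  assumes u: "u \<in> L2" and v: "v \<in> L2"
  shows "integrable lborel (\<lambda>x. u x * cnj (v x))"
proof (rule Bochner_Integration.integrable_bound[OF L2_mult_integrable_real[OF u v]])
  note [measurable] = L2_D(1)[OF u] L2_D(1)[OF v]
  show "(\<lambda>x. u x * cnj (v x)) \<in> borel_measurable lborel" by measurable
qed (auto simp: norm_mult)

text \<open>
  The quadratic polynomial \<open>t \<mapsto> \<integral> (t |u| - |v|)\<^sup>2\<close> is nonnegative; evaluating it at its minimum gives
  the inequality.
\<close>
lemma L2_Cauchy_Schwarz:
  assumes u: "u \<in> L2" and v: "v \<in> L2"
  shows "cmod (L2_inner u v) \<le> L2_norm u * L2_norm v"
proof -
  define a where "a = (L2_norm u)\<^sup>2"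
  define b where "b = (L2_norm v)\<^sup>2"
  define p where "p = (LINT x|lborel. cmod (u x) * cmod (v x))"
  note int = L2_D(2)[OF u] L2_D(2)[OF v] L2_mult_integrable_real[OF u v]
  have quad: "0 \<le> t\<^sup>2 * a - 2 * t * p + b" for t
  proof -
    have "0 \<le> (LINT x|lborel. (t * cmod (u x) - cmod (v x))\<^sup>2)" by simp
    also have "\<dots> = (LINT x|lborel. t\<^sup>2 * (cmod (u x))\<^sup>2 - 2 * t * (cmod (u x) * cmod (v x)) + (cmod (v x))\<^sup>2)"
      by (simp add: power2_diff power_mult_distrib algebra_simps)
    also have "\<dots> = t\<^sup>2 * a - 2 * t * p + b"
      using int by (simp add: a_def b_def p_def L2_norm_power2)
    finally show ?thesis .
  qed
  have p0: "0 \<le> p" by (simp add: p_def)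
  have "p\<^sup>2 \<le> a * b"
  proof (cases "a = 0")
    case True
    have "p = 0"
    proof (rule ccontr)
      assume "p \<noteq> 0"
      moreover have "0 \<le> b" by (simp add: b_def)
      ultimately show False using quad[of "(b + 1) / p"] \<open>p \<noteq> 0\<close> True by simp
    qed
    then show ?thesis using True by simp
  next
    case False
    then have "0 < a" by (simp add: a_def)
    then show ?thesis using quad[of "p / a"]
      by (simp add: power2_eq_square field_simps)
  qed
  also have "\<dots> = (L2_norm u * L2_norm v)\<^sup>2" by (simp add: a_def b_def power_mult_distrib)
  finally have "p \<le> L2_norm u * L2_norm v"
    by (rule power2_le_imp_le) (simp add: L2_norm_nonneg)
  moreover have "cmod (L2_inner u v) \<le> p"
    unfolding L2_inner_def p_def
    by (rule order_trans[OF integral_norm_bound]) (simp add: norm_mult)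
  ultimately show ?thesis by linarith
qed

lemma L2_inner_self: "L2_inner f f = of_real ((L2_norm f)\<^sup>2)"
  unfolding L2_inner_def L2_norm_power2 complex_norm_square[symmetric] of_real_power[symmetric]
  by (rule integral_complex_of_real)

lemma L2_norm_diff_power2:
  assumes u: "u \<in> L2" and v: "v \<in> L2"
  shows "(L2_norm (\<lambda>x. u x - v x))\<^sup>2 = (L2_norm u)\<^sup>2 - 2 * Re (L2_inner u v) + (L2_norm v)\<^sup>2"
proof -
  have "(cmod (z - w))\<^sup>2 = (cmod z)\<^sup>2 - 2 * Re (z * cnj w) + (cmod w)\<^sup>2" for z w
    unfolding cmod_power2 by (simp add: power2_eq_square algebra_simps)
  then show ?thesis
    using L2_D(2)[OF u] L2_D(2)[OF v] L2_mult_integrable[OF u v]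
      integral_Re[OF L2_mult_integrable[OF u v]] integrable_Re[OF L2_mult_integrable[OF u v]]
    by (simp add: L2_norm_power2 L2_inner_def del: times_complex.sel)
qed

text \<open>
  A triangle inequality for the squared norm, sufficient for all approximation arguments below.
\<close>
lemma L2_norm_diff_power2_le:
  assumes u: "u \<in> L2" and v: "v \<in> L2" and w: "w \<in> L2"
  shows "(L2_norm (\<lambda>x. u x - w x))\<^sup>2 \<le> 2 * (L2_norm (\<lambda>x. u x - v x))\<^sup>2 + 2 * (L2_norm (\<lambda>x. v x - w x))\<^sup>2"
proof -
  note int = L2_D(2)[OF L2_diff[OF u v]] L2_D(2)[OF L2_diff[OF v w]] L2_D(2)[OF L2_diff[OF u w]]
  have "(L2_norm (\<lambda>x. u x - w x))\<^sup>2
      \<le> (LINT x|lborel. 2 * (cmod (u x - v x))\<^sup>2 + 2 * (cmod (v x - w x))\<^sup>2)"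
    unfolding L2_norm_power2
  proof (rule integral_mono)
    show "(cmod (u x - w x))\<^sup>2 \<le> 2 * (cmod (u x - v x))\<^sup>2 + 2 * (cmod (v x - w x))\<^sup>2" for x
      using cmod_add_power2_le[of "u x - v x" "v x - w x"] by simp
  qed (use int in auto)
  also have "\<dots> = 2 * (L2_norm (\<lambda>x. u x - v x))\<^sup>2 + 2 * (L2_norm (\<lambda>x. v x - w x))\<^sup>2"
    using int by (simp add: L2_norm_power2)
  finally show ?thesis .
qed

lemma L2_norm_cmult: "L2_norm (\<lambda>x. c * f x) = cmod c * L2_norm f"
  by (simp add: L2_norm_def norm_mult power_mult_distrib real_sqrt_mult)

text \<open>
  On a ball the constants are integrable, and \<open>|u| \<le> 1 + |u|\<^sup>2\<close>.
\<close>
lemma L2_bounded_support_integrable: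
  fixes u :: "real^'d \<Rightarrow> complex"
  assumes u: "u \<in> L2" and supp: "\<And>x. x \<notin> cball 0 R \<Longrightarrow> u x = 0"
  shows "integrable lborel u"
proof (rule Bochner_Integration.integrable_bound)
  show "integrable lborel (\<lambda>x. indicat_real (cball 0 R) x + (cmod (u x))\<^sup>2)"
    using L2_D(2)[OF u] emeasure_bounded_finite[OF bounded_cball]
    by (intro Bochner_Integration.integrable_add integrable_real_indicator) auto
  show "u \<in> borel_measurable lborel" using L2_D(1)[OF u] by simp
  have "a \<le> 1 + a\<^sup>2" for a :: real
    using zero_le_power2[of "a - 1/2"] unfolding power2_diff by (simp add: power2_eq_square)
  then show "AE x in lborel. norm (u x) \<le> norm (indicat_real (cball 0 R) x + (cmod (u x))\<^sup>2)"
    using supp by (auto simp: indicator_def)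
qed

lemma L2_indicator:
  assumes "u \<in> L2" "S \<in> sets borel"
  shows "(\<lambda>x. indicator S x * u x) \<in> L2"
  using assms by (intro L2_bounded_mult[where C=1]) (auto simp: indicator_def)

lemma lborel_integral_translate:
  fixes f :: "real^'d \<Rightarrow> 'b::{banach,second_countable_topology}"
  assumes [measurable]: "f \<in> borel_measurable borel"
  shows "(LINT x|lborel. f (x - z)) = (LINT x|lborel. f x)"
proof -
  have "(LINT x|lborel. f x) = (LINT x|distr lborel borel ((+) (- z)). f x)"
    by (simp add: lborel_distr_plus)
  also have "\<dots> = (LINT x|lborel. f (x - z))"
    by (subst integral_distr) auto
  finally show ?thesis by simp
qed

lemma lborel_integrable_translate:
  fixes f :: "real^'d \<Rightarrow> 'b::{banach,second_countable_topology}"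
  assumes "integrable lborel f"
  shows "integrable lborel (\<lambda>x. f (x - z))"
proof -
  have "integrable (distr lborel borel ((+) (- z))) f"
    using assms by (simp add: lborel_distr_plus)
  then show ?thesis
    by (subst (asm) integrable_distr_eq) (use assms in auto)
qed

lemma L2_translate:
  assumes "u \<in> L2" shows "(\<lambda>x. u (x - z)) \<in> L2"
proof (rule L2_I[OF _ lborel_integrable_translate[OF L2_D(2)[OF assms]]])
  note [measurable] = L2_D(1)[OF assms]
  show "(\<lambda>x. u (x - z)) \<in> borel_measurable borel" by measurable
qed auto

lemma L2_norm_translate:
  assumes "u \<in> L2" shows "L2_norm (\<lambda>x. u (x - z)) = L2_norm u"
proof -
  note [measurable] = L2_D(1)[OF assms]
  show ?thesis
    unfolding L2_norm_def by (subst lborel_integral_translate[where f="\<lambda>x. (cmod (u x))\<^sup>2"]) auto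
qed

lemma lborel_integral_affine:
  fixes f :: "real^'d \<Rightarrow> complex"
  assumes [measurable]: "f \<in> borel_measurable borel" and s: "s \<noteq> 0"
  shows "(LINT x|lborel. f x) = of_real (\<bar>s\<bar> ^ CARD('d)) * (LINT x|lborel. f (t + s *\<^sub>R x))"
proof -
  have "(LINT x|lborel. f x)
      = (LINT x|density (distr lborel borel (\<lambda>x. t + s *\<^sub>R x)) (\<lambda>_. ennreal (\<bar>s\<bar> ^ DIM(real^'d))). f x)"
    using lborel_affine[of s t] s by simp
  also have "\<dots> = (LINT x|distr lborel borel (\<lambda>x. t + s *\<^sub>R x). (\<bar>s\<bar> ^ DIM(real^'d)) *\<^sub>R f x)"
    by (subst integral_density) auto
  also have "\<dots> = (LINT x|lborel. (\<bar>s\<bar> ^ CARD('d)) *\<^sub>R f (t + s *\<^sub>R x))"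
    by (subst integral_distr) auto
  finally show ?thesis by (simp add: scaleR_conv_of_real)
qed

section \<open>The Gaussian and its Fourier transform\<close>

definition gauss :: "real^'d \<Rightarrow> real" where
  "gauss x = exp (- (norm x)\<^sup>2 / 2)"

lemma gauss_measurable[measurable]: "gauss \<in> borel_measurable borel"
  unfolding gauss_def by measurable

text \<open>
  The characteristic function of the standard normal distribution.
\<close>
lemma gauss_iexp_1d:
  shows "integrable lborel (\<lambda>x. of_real (exp (- x\<^sup>2 / 2)) * iexp (x * t))"
    and "(LINT x|lborel. of_real (exp (- x\<^sup>2 / 2)) * iexp (x * t))
      = of_real (sqrt (2 * pi)) * of_real (exp (- t\<^sup>2 / 2))"
proof -
  interpret real_distribution std_normal_distribution by (rule real_dist_normal_dist)
  have eq: "std_normal_density x *\<^sub>R iexp (t * x)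
      = (1 / of_real (sqrt (2 * pi))) * (of_real (exp (- x\<^sup>2 / 2)) * iexp (x * t))" for x :: real
    by (simp add: normal_density_def scaleR_conv_of_real mult_ac)
  have "integrable std_normal_distribution (\<lambda>x. iexp (t * x))"
    by (rule integrable_iexp) auto
  then have i: "integrable lborel (\<lambda>x. std_normal_density x *\<^sub>R iexp (t * x))"
    by (subst (asm) integrable_density) auto
  then show int: "integrable lborel (\<lambda>x. of_real (exp (- x\<^sup>2 / 2)) * iexp (x * t))"
  proof -
    have "integrable lborel (\<lambda>x. complex_of_real (sqrt (2 * pi)) * (std_normal_density x *\<^sub>R iexp (t * x)))"
      by (rule integrable_mult_right) (rule i)
    then show ?thesis unfolding eq by simp
  qed
  have "complex_of_real (exp (- (t^2) / 2)) = (LINT x|std_normal_distribution. iexp (t * x))"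
    using char_std_normal_distribution by (simp add: char_def fun_eq_iff)
  also have "\<dots> = (LINT x|lborel. std_normal_density x *\<^sub>R iexp (t * x))"
    by (subst integral_density) auto
  also have "\<dots> = (1 / of_real (sqrt (2 * pi))) * (LINT x|lborel. of_real (exp (- x\<^sup>2 / 2)) * iexp (x * t))"
    unfolding eq using int by simp
  finally have e: "complex_of_real (exp (- (t^2) / 2))
      = (1 / of_real (sqrt (2 * pi))) * (LINT x|lborel. of_real (exp (- x\<^sup>2 / 2)) * iexp (x * t))" .
  show "(LINT x|lborel. of_real (exp (- x\<^sup>2 / 2)) * iexp (x * t))
      = of_real (sqrt (2 * pi)) * of_real (exp (- t\<^sup>2 / 2))"
    unfolding e by simp
qed

text \<open>
  Lebesgue measure on a Euclidean space is the image of the product of one-dimensional Lebesgue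
  measures under the coordinates.
\<close>
lemma lborel_integral_prod:
  fixes f :: "'a::euclidean_space \<Rightarrow> real \<Rightarrow> complex"
  assumes int: "\<And>b. b \<in> Basis \<Longrightarrow> integrable lborel (f b)"
  shows "integrable lborel (\<lambda>x. \<Prod>b\<in>Basis. f b (x \<bullet> b))"
    and "(LINT x|lborel. (\<Prod>b\<in>Basis. f b (x \<bullet> b))) = (\<Prod>b\<in>Basis. (LINT x|lborel. f b x))"
proof -
  interpret product_sigma_finite "\<lambda>b::'a. lborel :: real measure" ..
  have [measurable]: "f b \<in> borel_measurable borel" if "b \<in> Basis" for b
    using borel_measurable_integrable[OF int[OF that]] by simp
  have meas: "(\<lambda>x. \<Prod>b\<in>Basis. f b (x \<bullet> b)) \<in> borel_measurable (borel :: 'a measure)"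
    by measurable
  have [measurable]: "(\<lambda>g. \<Sum>b\<in>Basis. g b *\<^sub>R b) \<in> measurable (\<Pi>\<^sub>M b\<in>Basis. lborel) (borel :: 'a measure)"
    by measurable
  show "integrable lborel (\<lambda>x. \<Prod>b\<in>Basis. f b (x \<bullet> b))"
    unfolding lborel_eq[where 'a='a] using meas product_integrable_prod[OF finite_Basis int]
    by (subst integrable_distr_eq) simp_all
  show "(LINT x|lborel. (\<Prod>b\<in>Basis. f b (x \<bullet> b))) = (\<Prod>b\<in>Basis. (LINT x|lborel. f b x))"
    unfolding lborel_eq[where 'a='a] using meas product_integral_prod[OF finite_Basis int]
    by (subst integral_distr) simp_all
qed

text \<open>
  The Gaussian is a product of one-dimensional Gaussians, so up to a constant it is its own Fourier
  transform in every dimension.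
\<close>
lemma gauss_iexp:
  fixes z :: "real^'d"
  shows "integrable lborel (\<lambda>x. of_real (gauss x) * iexp (x \<bullet> z))"
    and "(LINT x|lborel. of_real (gauss x) * iexp (x \<bullet> z))
      = of_real (sqrt (2 * pi) ^ CARD('d)) * of_real (gauss z)"
proof -
  have g: "gauss y = (\<Prod>b\<in>Basis. exp (- (y \<bullet> b)\<^sup>2 / 2))" for y :: "real^'d"
    unfolding gauss_def exp_sum[OF finite_Basis, symmetric] power2_norm_eq_inner euclidean_inner[of y y]
    by (simp add: sum_divide_distrib sum_negf power2_eq_square)
  have e: "iexp (x \<bullet> z) = (\<Prod>b\<in>Basis. iexp ((x \<bullet> b) * (z \<bullet> b)))" for x
    unfolding exp_sum[OF finite_Basis, symmetric] euclidean_inner[of x z] by (simp add: sum_distrib_left)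
  have eq: "of_real (gauss x) * iexp (x \<bullet> z)
      = (\<Prod>b\<in>Basis. of_real (exp (- (x \<bullet> b)\<^sup>2 / 2)) * iexp ((x \<bullet> b) * (z \<bullet> b)))" for x
    unfolding g e by (simp add: prod.distrib)
  show "integrable lborel (\<lambda>x. of_real (gauss x) * iexp (x \<bullet> z))"
    unfolding eq by (rule lborel_integral_prod(1)) (rule gauss_iexp_1d)
  show "(LINT x|lborel. of_real (gauss x) * iexp (x \<bullet> z))
      = of_real (sqrt (2 * pi) ^ CARD('d)) * of_real (gauss z)"
    unfolding eq lborel_integral_prod(2)[OF gauss_iexp_1d(1)] gauss_iexp_1d(2)
    unfolding g prod.distrib by simp
qed

lemma gauss_integrable: "integrable lborel (gauss :: real^'d \<Rightarrow> real)"
proof -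
  have "(\<lambda>x. norm (of_real (gauss x) * iexp (x \<bullet> 0))) = (gauss :: real^'d \<Rightarrow> real)"
    by (simp add: gauss_def fun_eq_iff)
  then show ?thesis using integrable_norm[OF gauss_iexp(1)[of 0]] by metis
qed

lemma gauss_integral: "(LINT x|lborel. gauss (x :: real^'d)) = sqrt (2 * pi) ^ CARD('d)"
proof -
  have "complex_of_real (LINT x|lborel. gauss (x :: real^'d))
      = (LINT x|lborel. of_real (gauss (x :: real^'d)) * iexp (x \<bullet> 0))"
    by (simp only: integral_complex_of_real[symmetric] inner_zero_right of_real_0 mult_zero_right exp_zero mult_1_right)
  also have "\<dots> = of_real (sqrt (2 * pi) ^ CARD('d))"
    unfolding gauss_iexp(2) by (simp only: gauss_def norm_zero) simp
  finally show ?thesis by (simp only: of_real_eq_iff)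
qed

section \<open>Translations are continuous in the mean\<close>

lemma L2_truncation_tendsto:
  fixes h :: "real^'d \<Rightarrow> complex"
  assumes h: "h \<in> L2"
  shows "(\<lambda>n. (L2_norm (\<lambda>x. h x - (if norm x \<le> real n \<and> cmod (h x) \<le> real n then h x else 0)))\<^sup>2)
    \<longlonglongrightarrow> 0"
proof -
  note [measurable] = L2_D(1)[OF h]
  have "(\<lambda>n. LINT x|lborel. (cmod (h x - (if norm x \<le> real n \<and> cmod (h x) \<le> real n then h x else 0)))\<^sup>2)
    \<longlonglongrightarrow> (LINT x::real^'d|lborel. 0)"
  proof (rule integral_dominated_convergence[where w="\<lambda>x. (cmod (h x))\<^sup>2"])
    show "AE x in lborel. (\<lambda>n. (cmod (h x - (if norm x \<le> real n \<and> cmod (h x) \<le> real n then h x else 0)))\<^sup>2)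
        \<longlonglongrightarrow> 0"
    proof (rule AE_I2, rule tendsto_eventually)
      fix x
      obtain k where "max (norm x) (cmod (h x)) \<le> real k" using real_arch_simple by blast
      then show "\<forall>\<^sub>F n in sequentially.
          (cmod (h x - (if norm x \<le> real n \<and> cmod (h x) \<le> real n then h x else 0)))\<^sup>2 = 0"
        by (intro eventually_sequentiallyI[of k]) auto
    qed
  qed (use L2_D(2)[OF h] in auto)
  then show ?thesis by (simp add: L2_norm_power2)
qed

text \<open>
  Continuous functions with bounds on size and support that are uniform along the approximating
  sequences, so that dominated convergence applies.
\<close>
definition bump_function :: "(real^'d \<Rightarrow> complex) \<Rightarrow> real \<Rightarrow> real \<Rightarrow> bool" where
  "bump_function f M R \<longleftrightarrow>
     continuous_on UNIV f \<and> (\<forall>x. cmod (f x) \<le> M) \<and> (\<forall>x. x \<notin> cball 0 R \<longrightarrow> f x = 0)"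

lemma integrable_const_cball:
  "integrable lborel (\<lambda>x :: real^'d. c * indicat_real (cball 0 R) x)"
  using emeasure_bounded_finite[OF bounded_cball]
  by (intro integrable_mult_right integrable_real_indicator) auto

lemma L2_of_bounded:
  fixes f :: "real^'d \<Rightarrow> complex"
  assumes "f \<in> borel_measurable borel" "\<And>x. cmod (f x) \<le> M" "\<And>x. x \<notin> cball 0 R \<Longrightarrow> f x = 0"
  shows "f \<in> L2"
proof (rule L2_I[OF assms(1) integrable_const_cball[of "M\<^sup>2" R]])
  show "(cmod (f x))\<^sup>2 \<le> M\<^sup>2 * indicat_real (cball 0 R) x" for x
    using assms(2,3)[of x] by (auto simp: indicator_def intro!: power_mono)
qed

lemma bump_function_L2:
  assumes "bump_function f M R" shows "f \<in> L2"
  using assms unfolding bump_function_def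
  by (intro L2_of_bounded[of f M R] borel_measurable_continuous_onI) auto

text \<open>
  A measurable function is almost everywhere the limit of continuous functions. Clipping these at
  height \<open>M\<close> and multiplying them by a continuous cutoff does not change the limit, since \<open>u\<close> already
  obeys both restrictions, and makes dominated convergence available.
\<close>
lemma bump_approximation_bounded:
  fixes u :: "real^'d \<Rightarrow> complex"
  assumes [measurable]: "u \<in> borel_measurable borel" and M: "0 < M" "\<And>x. cmod (u x) \<le> M"
    and supp: "\<And>x. x \<notin> cball 0 R \<Longrightarrow> u x = 0"
  shows "\<exists>\<psi>. (\<forall>n. bump_function (\<psi> n) M (R + 1)) \<and> (\<lambda>n. (L2_norm (\<lambda>x. u x - \<psi> n x))\<^sup>2) \<longlonglongrightarrow> 0"
proof -
  have "u measurable_on UNIV"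
    by (subst measurable_on_iff_borel_measurable)
      (auto intro!: measurable_restrict_space1 measurable_completion)
  then obtain N \<phi> where N: "negligible N" and \<phi>: "\<And>n. continuous_on UNIV (\<phi> n)"
      and lim: "\<And>x. x \<notin> N \<Longrightarrow> (\<lambda>n. \<phi> n x) \<longlonglongrightarrow> u x"
    unfolding measurable_on_def by auto
  \<comment> \<open>\<open>T\<close> is the radial retraction of the plane onto the disc of radius \<open>M\<close>.\<close>
define T where "T z = z /\<^sub>R max 1 (cmod z / M)" for z
  define \<eta> :: "real^'d \<Rightarrow> real" where "\<eta> x = max 0 (min 1 (R + 1 - norm x))" for x
  define \<psi> where "\<psi> n x = \<eta> x *\<^sub>R T (\<phi> n x)" for n x
  have T_cont: "continuous_on UNIV T"
    unfolding T_def by (intro continuous_intros) (use M in auto)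
  have T_bound: "cmod (T z) \<le> M" for z
    using M(1) by (auto simp: T_def divide_simps max_def)
  have T_id: "T z = z" if "cmod z \<le> M" for z
    using that M(1) by (simp add: T_def max_def)
  have \<eta>_cont: "continuous_on UNIV \<eta>" unfolding \<eta>_def by (intro continuous_intros)
  have bump: "bump_function (\<psi> n) M (R + 1)" for n
    unfolding bump_function_def
  proof (intro conjI allI impI)
    show "continuous_on UNIV (\<psi> n)"
      unfolding \<psi>_def
      by (intro continuous_intros \<eta>_cont continuous_on_compose2[OF T_cont \<phi>]) auto
    show "cmod (\<psi> n x) \<le> M" for x
    proof -
      have "cmod (\<psi> n x) = \<bar>\<eta> x\<bar> * cmod (T (\<phi> n x))" by (simp add: \<psi>_def)
      also have "\<dots> \<le> 1 * M"
        by (intro mult_mono T_bound) (auto simp: \<eta>_def)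
      finally show ?thesis by simp
    qed
    show "\<psi> n x = 0" if "x \<notin> cball 0 (R + 1)" for x
      using that by (simp add: \<psi>_def \<eta>_def)
  qed
  have \<psi>_meas [measurable]: "\<psi> n \<in> borel_measurable borel" for n
    using bump[of n] by (auto simp: bump_function_def intro: borel_measurable_continuous_onI)
  have "(\<lambda>n. LINT x|lborel. (cmod (u x - \<psi> n x))\<^sup>2) \<longlonglongrightarrow> (LINT x::real^'d|lborel. 0)"
  proof (rule integral_dominated_convergence)
    show "integrable lborel (\<lambda>x :: real^'d. (2 * M)\<^sup>2 * indicat_real (cball 0 (R + 1)) x)"
      by (rule integrable_const_cball)
    have "AE x in lborel. x \<notin> N"
      using N AE_not_in[of N lebesgue] by (simp add: negligible_iff_null_sets AE_completion_iff)
    then show "AE x in lborel. (\<lambda>n. (cmod (u x - \<psi> n x))\<^sup>2) \<longlonglongrightarrow> 0"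
    proof eventually_elim
      case (elim x)
      have "isCont T (u x)" using T_cont by (simp add: continuous_on_eq_continuous_at)
      then have "(\<lambda>n. T (\<phi> n x)) \<longlonglongrightarrow> T (u x)" using lim[OF elim] isCont_tendsto_compose by blast
      then have "(\<lambda>n. \<psi> n x) \<longlonglongrightarrow> \<eta> x *\<^sub>R u x"
        unfolding \<psi>_def T_id[OF M(2)] by (intro tendsto_intros)
      moreover have "\<eta> x *\<^sub>R u x = u x"
        using supp[of x] by (cases "x \<in> cball 0 R") (auto simp: \<eta>_def)
      ultimately have "(\<lambda>n. (cmod (u x - \<psi> n x))\<^sup>2) \<longlonglongrightarrow> (cmod (u x - u x))\<^sup>2"
        by (intro tendsto_intros) simp
      then show ?case by simp
    qed
    show "AE x in lborel. norm ((cmod (u x - \<psi> n x))\<^sup>2) \<le> (2 * M)\<^sup>2 * indicat_real (cball 0 (R + 1)) x" for n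
    proof (rule AE_I2)
      fix x :: "real^'d"
      have "cmod (u x - \<psi> n x) \<le> 2 * M"
        using norm_triangle_ineq4[of "u x" "\<psi> n x"] M(2)[of x] bump[of n]
        unfolding bump_function_def by (smt (verit))
      then have "(cmod (u x - \<psi> n x))\<^sup>2 \<le> (2 * M)\<^sup>2" by (intro power_mono) auto
      moreover have "u x - \<psi> n x = 0" if "x \<notin> cball 0 (R + 1)"
        using supp[of x] bump[of n] that by (auto simp: bump_function_def)
      ultimately show "norm ((cmod (u x - \<psi> n x))\<^sup>2) \<le> (2 * M)\<^sup>2 * indicat_real (cball 0 (R + 1)) x"
        by (cases "x \<in> cball 0 (R + 1)") auto
    qed
  qed auto
  then have "(\<lambda>n. (L2_norm (\<lambda>x. u x - \<psi> n x))\<^sup>2) \<longlonglongrightarrow> 0" by (simp add: L2_norm_power2)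
  with bump show ?thesis by blast
qed

lemma bump_approximation:
  fixes h :: "real^'d \<Rightarrow> complex"
  assumes h: "h \<in> L2" and e: "0 < e"
  obtains \<phi> M R where "bump_function \<phi> M R" "(L2_norm (\<lambda>x. h x - \<phi> x))\<^sup>2 < e"
proof -
  note [measurable] = L2_D(1)[OF h]
  define u where "u n x = (if norm x \<le> real n \<and> cmod (h x) \<le> real n then h x else 0)" for n x
  have u_meas [measurable]: "u n \<in> borel_measurable borel" for n unfolding u_def by measurable
  have "\<forall>\<^sub>F n in sequentially. (L2_norm (\<lambda>x. h x - u n x))\<^sup>2 < e / 4"
    using order_tendstoD(2)[OF L2_truncation_tendsto[OF h], of "e / 4"] e by (simp add: u_def)
  then obtain n where n: "(L2_norm (\<lambda>x. h x - u n x))\<^sup>2 < e / 4"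
    by (auto simp: eventually_sequentially)
  have un: "cmod (u n x) \<le> real n + 1" "x \<notin> cball 0 (real n) \<Longrightarrow> u n x = 0" for x
    by (auto simp: u_def)
  have uL2: "u n \<in> L2" using un by (intro L2_of_bounded[of _ "real n + 1" "real n"]) auto
  obtain \<psi> where \<psi>: "\<And>k. bump_function (\<psi> k) (real n + 1) (real n + 1)"
      "(\<lambda>k. (L2_norm (\<lambda>x. u n x - \<psi> k x))\<^sup>2) \<longlonglongrightarrow> 0"
    using bump_approximation_bounded[OF u_meas _ un, of n] by auto
  have "\<forall>\<^sub>F k in sequentially. (L2_norm (\<lambda>x. u n x - \<psi> k x))\<^sup>2 < e / 4"
    using order_tendstoD(2)[OF \<psi>(2), of "e / 4"] e by simp
  then obtain k where k: "(L2_norm (\<lambda>x. u n x - \<psi> k x))\<^sup>2 < e / 4"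
    by (auto simp: eventually_sequentially)
  have "(L2_norm (\<lambda>x. h x - \<psi> k x))\<^sup>2 < e"
    using L2_norm_diff_power2_le[OF h uL2 bump_function_L2[OF \<psi>(1)[of k]]] n k by simp
  then show ?thesis using that \<psi>(1) by blast
qed

lemma bump_translate_tendsto:
  fixes \<phi> :: "real^'d \<Rightarrow> complex"
  assumes \<phi>: "bump_function \<phi> M R" and z: "z \<longlonglongrightarrow> 0"
  shows "(\<lambda>n. (L2_norm (\<lambda>x. \<phi> (x - z n) - \<phi> x))\<^sup>2) \<longlonglongrightarrow> 0"
proof -
  have cont: "continuous_on UNIV \<phi>" and M: "\<And>x. cmod (\<phi> x) \<le> M" and supp: "\<And>x. x \<notin> cball 0 R \<Longrightarrow> \<phi> x = 0"
    using \<phi> by (auto simp: bump_function_def)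
  have [measurable]: "\<phi> \<in> borel_measurable borel" using cont by (rule borel_measurable_continuous_onI)
  obtain K where K: "0 < K" "\<And>n. norm (z n) \<le> K"
    using convergent_imp_Bseq[OF convergentI[OF z]] by (auto simp: Bseq_def)
  have "(\<lambda>n. LINT x|lborel. (cmod (\<phi> (x - z n) - \<phi> x))\<^sup>2) \<longlonglongrightarrow> (LINT x::real^'d|lborel. 0)"
  proof (rule integral_dominated_convergence)
    show "integrable lborel (\<lambda>x :: real^'d. (2 * M)\<^sup>2 * indicat_real (cball 0 (R + K)) x)"
      by (rule integrable_const_cball)
    show "AE x in lborel. (\<lambda>n. (cmod (\<phi> (x - z n) - \<phi> x))\<^sup>2) \<longlonglongrightarrow> 0"
    proof (rule AE_I2)
      fix x
      have "(\<lambda>n. x - z n) \<longlonglongrightarrow> x - 0" by (intro tendsto_intros z)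
      then have "(\<lambda>n. \<phi> (x - z n)) \<longlonglongrightarrow> \<phi> x"
        using cont by (intro isCont_tendsto_compose[of x \<phi>]) (auto simp: continuous_on_eq_continuous_at)
      then have "(\<lambda>n. (cmod (\<phi> (x - z n) - \<phi> x))\<^sup>2) \<longlonglongrightarrow> (cmod (\<phi> x - \<phi> x))\<^sup>2"
        by (intro tendsto_intros)
      then show "(\<lambda>n. (cmod (\<phi> (x - z n) - \<phi> x))\<^sup>2) \<longlonglongrightarrow> 0" by simp
    qed
    show "AE x in lborel. norm ((cmod (\<phi> (x - z n) - \<phi> x))\<^sup>2) \<le> (2 * M)\<^sup>2 * indicat_real (cball 0 (R + K)) x" for n
    proof (rule AE_I2)
      fix x :: "real^'d"
      have "cmod (\<phi> (x - z n) - \<phi> x) \<le> 2 * M"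
        using norm_triangle_ineq4[of "\<phi> (x - z n)" "\<phi> x"] M[of x] M[of "x - z n"] by linarith
      then have "(cmod (\<phi> (x - z n) - \<phi> x))\<^sup>2 \<le> (2 * M)\<^sup>2" by (intro power_mono) auto
      moreover have "\<phi> (x - z n) - \<phi> x = 0" if "x \<notin> cball 0 (R + K)"
        using supp[of x] supp[of "x - z n"] that K(1) K(2)[of n] norm_triangle_sub[of x "z n"] by auto
      ultimately show "norm ((cmod (\<phi> (x - z n) - \<phi> x))\<^sup>2) \<le> (2 * M)\<^sup>2 * indicat_real (cball 0 (R + K)) x"
        by (cases "x \<in> cball 0 (R + K)") auto
    qed
  qed auto
  then show ?thesis by (simp add: L2_norm_power2)
qed

text \<open>
  Translation is an isometry, so it is enough to treat a dense set of functions; for continuous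
  functions of bounded support the claim is dominated convergence.
\<close>
lemma L2_translate_tendsto:
  fixes h :: "real^'d \<Rightarrow> complex"
  assumes h: "h \<in> L2" and z: "z \<longlonglongrightarrow> 0"
  shows "(\<lambda>n. L2_norm (\<lambda>x. h (x - z n) - h x)) \<longlonglongrightarrow> 0"
proof -
  have "(\<lambda>n. (L2_norm (\<lambda>x. h (x - z n) - h x))\<^sup>2) \<longlonglongrightarrow> 0"
  proof (rule order_tendstoI)
    fix e :: real assume e: "0 < e"
    \<comment> \<open>Two uses of the squared triangle inequality give \<open>6 e/12 + 4 e/8 = e\<close>.\<close>
then obtain \<phi> M R where \<phi>: "bump_function \<phi> M R" "(L2_norm (\<lambda>x. h x - \<phi> x))\<^sup>2 < e / 12"
      using bump_approximation[OF h, of "e / 12"] by auto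
    note \<phi>L2 = bump_function_L2[OF \<phi>(1)]
    have "\<forall>\<^sub>F n in sequentially. (L2_norm (\<lambda>x. \<phi> (x - z n) - \<phi> x))\<^sup>2 < e / 8"
      using order_tendstoD(2)[OF bump_translate_tendsto[OF \<phi>(1) z], of "e / 8"] e by simp
    then show "\<forall>\<^sub>F n in sequentially. (L2_norm (\<lambda>x. h (x - z n) - h x))\<^sup>2 < e"
    proof eventually_elim
      case (elim n)
      have 1: "L2_norm (\<lambda>x. h (x - z n) - \<phi> (x - z n)) = L2_norm (\<lambda>x. h x - \<phi> x)"
        using L2_norm_translate[OF L2_diff[OF h \<phi>L2], of "z n"] .
      have 2: "L2_norm (\<lambda>x. \<phi> x - h x) = L2_norm (\<lambda>x. h x - \<phi> x)"
        by (simp add: L2_norm_def norm_minus_commute)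
      show ?case
        using L2_norm_diff_power2_le[OF L2_translate[OF h] L2_translate[OF \<phi>L2] h, of "z n" "z n"]
          L2_norm_diff_power2_le[OF L2_translate[OF \<phi>L2] \<phi>L2 h, of "z n"] \<phi>(2) elim
        unfolding 1 2 by linarith
    qed
  qed (simp add: order_less_le_trans)
  then have "(\<lambda>n. sqrt ((L2_norm (\<lambda>x. h (x - z n) - h x))\<^sup>2)) \<longlonglongrightarrow> sqrt 0"
    by (intro tendsto_intros)
  then show ?thesis by (simp add: L2_norm_nonneg)
qed

lemma L2_inner_translate_tendsto:
  fixes g h :: "real^'d \<Rightarrow> complex"
  assumes g: "g \<in> L2" and h: "h \<in> L2" and z: "z \<longlonglongrightarrow> 0"
  shows "(\<lambda>n. L2_inner g (\<lambda>x. h (x - z n))) \<longlonglongrightarrow> L2_inner g h"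
proof -
  have "(\<lambda>n. L2_inner g (\<lambda>x. h (x - z n)) - L2_inner g h) \<longlonglongrightarrow> 0"
  proof (rule Lim_null_comparison)
    show "\<forall>\<^sub>F n in sequentially. norm (L2_inner g (\<lambda>x. h (x - z n)) - L2_inner g h)
        \<le> L2_norm g * L2_norm (\<lambda>x. h (x - z n) - h x)"
    proof (intro always_eventually allI)
      fix n
      have "L2_inner g (\<lambda>x. h (x - z n)) - L2_inner g h = L2_inner g (\<lambda>x. h (x - z n) - h x)"
        using L2_mult_integrable[OF g L2_translate[OF h, of "z n"]] L2_mult_integrable[OF g h]
        by (simp add: L2_inner_def algebra_simps)
      then show "norm (L2_inner g (\<lambda>x. h (x - z n)) - L2_inner g h)
          \<le> L2_norm g * L2_norm (\<lambda>x. h (x - z n) - h x)"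
        using L2_Cauchy_Schwarz[OF g L2_diff[OF L2_translate[OF h, of "z n"] h]] by simp
    qed
    show "(\<lambda>n. L2_norm g * L2_norm (\<lambda>x. h (x - z n) - h x)) \<longlonglongrightarrow> 0"
      using tendsto_mult_left[OF L2_translate_tendsto[OF h z], of "L2_norm g"] by simp
  qed
  then show ?thesis by (simp add: LIM_zero_iff)
qed

section \<open>The Plancherel theorem\<close>

text \<open>
  The exponent has a positive sign and there is no normalising factor: up to \<open>(2\<pi>)\<^sup>d\<close> this is the
  inverse Fourier transform. The forward transform is recovered by complex conjugation.
\<close>
definition fourier_integral :: "(real^'d \<Rightarrow> complex) \<Rightarrow> real^'d \<Rightarrow> complex" where
  "fourier_integral g x = (LINT \<omega>|lborel. g \<omega> * iexp (\<omega> \<bullet> x))"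

lemma fourier_integral_measurable [measurable]:
  assumes [measurable]: "g \<in> borel_measurable borel"
  shows "fourier_integral g \<in> borel_measurable borel"
  unfolding fourier_integral_def by measurable

lemma integrable_iexp_mult:
  fixes g :: "real^'d \<Rightarrow> complex"
  assumes "integrable lborel g"
  shows "integrable lborel (\<lambda>\<omega>. g \<omega> * iexp (\<omega> \<bullet> x))"
proof -
  note [measurable] = borel_measurable_integrable[OF assms]
  show ?thesis
    by (rule Bochner_Integration.integrable_bound[OF assms]) (auto simp: norm_mult)
qed

lemma integrable_pair_mult:
  fixes f :: "'a::euclidean_space \<Rightarrow> complex" and g :: "'b::euclidean_space \<Rightarrow> complex"
  assumes f: "integrable lborel f" and g: "integrable lborel g"
  shows "integrable (lborel \<Otimes>\<^sub>M lborel) (\<lambda>(x, y). f x * g y)"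
proof (rule lborel_pair.Fubini_integrable)
  note [measurable] = borel_measurable_integrable[OF f] borel_measurable_integrable[OF g]
  show "(\<lambda>(x, y). f x * g y) \<in> borel_measurable (lborel \<Otimes>\<^sub>M lborel)" by measurable
qed (use f g in \<open>auto simp: norm_mult intro!: integrable_mult_right\<close>)

text \<open>
  The Fourier transform of a Gaussian of width \<open>1/s\<close> is one of width \<open>s\<close>; it is stated at the point
  \<open>s z\<close>, where it appears after the substitution in \<open>Plancherel_gauss\<close>.
\<close>
lemma gauss_scaled:
  fixes z :: "real^'d"
  assumes s: "0 < s"
  shows "integrable lborel (\<lambda>x::real^'d. of_real (gauss (s *\<^sub>R x)) :: complex)"
    and "of_real (s ^ CARD('d)) * (LINT x|lborel. of_real (gauss (s *\<^sub>R x)) * iexp ((s *\<^sub>R z) \<bullet> x))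
      = of_real (sqrt (2 * pi) ^ CARD('d)) * of_real (gauss z)"
proof -
  show "integrable lborel (\<lambda>x::real^'d. of_real (gauss (s *\<^sub>R x)) :: complex)"
  proof -
    have "integrable (density (distr lborel borel (\<lambda>x::real^'d. 0 + s *\<^sub>R x)) (\<lambda>_. ennreal (\<bar>s\<bar> ^ DIM(real^'d)))) gauss"
      using lborel_affine[of s "0::real^'d"] s gauss_integrable by simp
    then have "integrable (distr lborel borel (\<lambda>x::real^'d. 0 + s *\<^sub>R x)) (\<lambda>x. (\<bar>s\<bar> ^ DIM(real^'d)) *\<^sub>R gauss x)"
      by (subst (asm) integrable_density) auto
    then have "integrable lborel (\<lambda>x::real^'d. gauss (s *\<^sub>R x))"
      using s by (subst (asm) integrable_distr_eq) auto
    then show ?thesis by (rule integrable_of_real)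
  qed
  have [measurable]: "(\<lambda>x::real^'d. of_real (gauss x) * iexp (x \<bullet> z)) \<in> borel_measurable borel"
    by measurable
  show "of_real (s ^ CARD('d)) * (LINT x|lborel. of_real (gauss (s *\<^sub>R x)) * iexp ((s *\<^sub>R z) \<bullet> x))
      = of_real (sqrt (2 * pi) ^ CARD('d)) * of_real (gauss z)"
    using lborel_integral_affine[of "\<lambda>x. of_real (gauss x) * iexp (x \<bullet> z)" s 0] gauss_iexp(2)[of z] s
    by (simp add: inner_commute)
qed

lemma fst_snd_borel [measurable]:
  "fst \<in> borel_measurable (borel :: ('a::topological_space \<times> 'b::topological_space) measure)"
  "snd \<in> borel_measurable (borel :: ('a::topological_space \<times> 'b::topological_space) measure)"
  by (auto intro!: borel_measurable_continuous_onI continuous_intros)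

lemma fourier_integral_mult_cnj:
  fixes g h :: "real^'d \<Rightarrow> complex"
  assumes g: "integrable lborel g" and h: "integrable lborel h"
  shows "fourier_integral g x * cnj (fourier_integral h x)
    = (LINT p|lborel. g (fst p) * cnj (h (snd p)) * iexp ((fst p - snd p) \<bullet> x))"
proof -
  have cnjh: "cnj (fourier_integral h x) = (LINT \<eta>|lborel. cnj (h \<eta>) * iexp (- (\<eta> \<bullet> x)))"
    unfolding fourier_integral_def using Bochner_Integration.integral_cnj[of lborel "\<lambda>\<eta>. h \<eta> * iexp (\<eta> \<bullet> x)"]
    by (simp add: exp_cnj)
  have int: "integrable lborel (\<lambda>\<eta>. cnj (h \<eta>) * iexp (- (\<eta> \<bullet> x)))"
    using integrable_cnj[OF integrable_iexp_mult[OF h, of x]] by (simp add: exp_cnj)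
  have pair: "integrable (lborel \<Otimes>\<^sub>M lborel)
      (\<lambda>(\<omega>, \<eta>). (g \<omega> * iexp (\<omega> \<bullet> x)) * (cnj (h \<eta>) * iexp (- (\<eta> \<bullet> x))))"
    by (intro integrable_pair_mult integrable_iexp_mult g int)
  have "fourier_integral g x * cnj (fourier_integral h x)
      = (LINT \<omega>|lborel. (LINT \<eta>|lborel. (g \<omega> * iexp (\<omega> \<bullet> x)) * (cnj (h \<eta>) * iexp (- (\<eta> \<bullet> x)))))"
    unfolding cnjh using int integrable_iexp_mult[OF g, of x] by (simp add: fourier_integral_def)
  also have "\<dots> = (LINT p|(lborel \<Otimes>\<^sub>M lborel).
      (case p of (\<omega>, \<eta>) \<Rightarrow> (g \<omega> * iexp (\<omega> \<bullet> x)) * (cnj (h \<eta>) * iexp (- (\<eta> \<bullet> x)))))"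
    using lborel_pair.integral_fst'[OF pair] by simp
  also have "\<dots> = (LINT p|lborel. g (fst p) * cnj (h (snd p)) * iexp ((fst p - snd p) \<bullet> x))"
    unfolding lborel_prod
  proof (rule Bochner_Integration.integral_cong[OF refl])
    fix p :: "(real^'d) \<times> (real^'d)"
    have "iexp ((fst p - snd p) \<bullet> x) = iexp (fst p \<bullet> x) * iexp (- (snd p \<bullet> x))"
      by (simp add: inner_diff_left algebra_simps flip: exp_add)
    then show "(case p of (\<omega>, \<eta>) \<Rightarrow> (g \<omega> * iexp (\<omega> \<bullet> x)) * (cnj (h \<eta>) * iexp (- (\<eta> \<bullet> x))))
        = g (fst p) * cnj (h (snd p)) * iexp ((fst p - snd p) \<bullet> x)"
      by (simp add: case_prod_beta)
  qed
  finally show ?thesis .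
qed

text \<open>
  The weight \<open>gauss (s x)\<close> makes the triple integral over \<open>x\<close>, \<open>\<omega>\<close>, \<open>\<eta>\<close> absolutely convergent. Doing
  the \<open>x\<close>-integral first leaves \<open>g(\<omega>) \<cdot> cnj (h(\<eta>))\<close> against a Gaussian in \<open>\<omega> - \<eta>\<close> that concentrates at
  \<open>0\<close> as \<open>s\<close> tends to \<open>0\<close>; the substitution \<open>\<eta> = \<omega> - s z\<close> makes its width independent of \<open>s\<close>.
\<close>
lemma Plancherel_gauss:
  fixes g h :: "real^'d \<Rightarrow> complex"
  assumes g: "integrable lborel g" "g \<in> L2" and h: "integrable lborel h" "h \<in> L2" and s: "0 < s"
  shows "(LINT x|lborel. of_real (gauss (s *\<^sub>R x)) * (fourier_integral g x * cnj (fourier_integral h x)))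
    = of_real (sqrt (2 * pi) ^ CARD('d)) * (LINT z|lborel. of_real (gauss z) * L2_inner g (\<lambda>\<omega>. h (\<omega> - s *\<^sub>R z)))"
proof -
  note [measurable] = L2_D(1)[OF g(2)] L2_D(1)[OF h(2)]
  define G where "G p = g (fst p) * cnj (h (snd p))" for p
  have G_meas [measurable]: "G \<in> borel_measurable borel"
    unfolding G_def by measurable
  have G_int: "integrable lborel G"
    using integrable_pair_mult[OF g(1) integrable_cnj[OF h(1)]]
    by (simp add: lborel_prod case_prod_unfold G_def[abs_def])
  define K where "K z = (LINT x|lborel. of_real (gauss (s *\<^sub>R x)) * iexp (z \<bullet> x))" for z :: "real^'d"
  have K_meas [measurable]: "K \<in> borel_measurable borel" unfolding K_def by measurable
  have K_bound: "cmod (K z) \<le> K0" if "K0 = (LINT x|lborel. gauss (s *\<^sub>R (x::real^'d)))" for z K0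
    unfolding K_def that
    by (rule order_trans[OF integral_norm_bound]) (simp add: norm_mult gauss_def)
  have triple: "integrable (lborel \<Otimes>\<^sub>M lborel)
      (\<lambda>(x, p). (of_real (gauss (s *\<^sub>R x)) * G p) * iexp ((fst p - snd p) \<bullet> x))"
  proof (rule Bochner_Integration.integrable_bound[OF integrable_pair_mult[OF gauss_scaled(1)[OF s] G_int]])
    show "(\<lambda>(x, p). (of_real (gauss (s *\<^sub>R x)) * G p) * iexp ((fst p - snd p) \<bullet> x))
        \<in> borel_measurable (lborel \<Otimes>\<^sub>M lborel)"
      by measurable
  qed (auto simp: norm_mult)
  have "(LINT x|lborel. of_real (gauss (s *\<^sub>R x)) * (fourier_integral g x * cnj (fourier_integral h x)))
      = (LINT x|lborel. (LINT p|lborel. (of_real (gauss (s *\<^sub>R x)) * G p) * iexp ((fst p - snd p) \<bullet> x)))"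
    unfolding fourier_integral_mult_cnj[OF g(1) h(1)] G_def[symmetric] by (simp add: mult.assoc)
  also have "\<dots> = (LINT p|lborel. (LINT x|lborel. (of_real (gauss (s *\<^sub>R x)) * G p) * iexp ((fst p - snd p) \<bullet> x)))"
    using lborel_pair.Fubini_integral[OF triple] by simp
  also have "\<dots> = (LINT p|lborel. G p * K (fst p - snd p))"
    by (simp add: K_def mult_ac flip: integral_mult_right_zero)
  also have "\<dots> = (LINT \<omega>|lborel. (LINT \<eta>|lborel. g \<omega> * cnj (h \<eta>) * K (\<omega> - \<eta>)))"
  proof -
    have "integrable lborel (\<lambda>p. K (fst p - snd p) * G p)"
    proof (rule Bochner_Integration.integrable_bound)
      show "integrable lborel (\<lambda>p. (LINT x|lborel. gauss (s *\<^sub>R (x::real^'d))) * norm (G p))"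
        using G_int by simp
      show "(\<lambda>p. K (fst p - snd p) * G p) \<in> borel_measurable lborel"
        by measurable
      show "AE p in lborel. norm (K (fst p - snd p) * G p)
          \<le> norm ((LINT x|lborel. gauss (s *\<^sub>R (x::real^'d))) * norm (G p))"
        using K_bound by (auto simp: norm_mult intro!: mult_right_mono order_trans[OF _ abs_ge_self])
    qed
    then have "integrable (lborel \<Otimes>\<^sub>M lborel) (\<lambda>p. G p * K (fst p - snd p))"
      by (simp add: lborel_prod mult.commute)
    from lborel_pair.integral_fst'[OF this] show ?thesis
      by (simp add: lborel_prod G_def)
  qed
  also have "\<dots> = (LINT \<omega>|lborel. (LINT z|lborel. of_real (sqrt (2 * pi) ^ CARD('d))
      * (of_real (gauss z) * (g \<omega> * cnj (h (\<omega> - s *\<^sub>R z))))))"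
  proof (rule Bochner_Integration.integral_cong[OF refl])
    fix \<omega>
    have "(LINT \<eta>|lborel. g \<omega> * cnj (h \<eta>) * K (\<omega> - \<eta>)) = (LINT z|lborel. g \<omega> * cnj (h (\<omega> - z)) * K z)"
      using lborel_integral_affine[of "\<lambda>\<eta>. g \<omega> * cnj (h \<eta>) * K (\<omega> - \<eta>)" "-1" \<omega>] by simp
    also have "\<dots> = of_real (s ^ CARD('d)) * (LINT z|lborel. g \<omega> * cnj (h (\<omega> - s *\<^sub>R z)) * K (s *\<^sub>R z))"
      using s lborel_integral_affine[of "\<lambda>z. g \<omega> * cnj (h (\<omega> - z)) * K z" s 0] by simp
    also have "\<dots> = (LINT z|lborel. (g \<omega> * cnj (h (\<omega> - s *\<^sub>R z))) * (of_real (s ^ CARD('d)) * K (s *\<^sub>R z)))"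
      by (simp add: mult_ac flip: integral_mult_right_zero)
    also have "\<dots> = (LINT z|lborel. of_real (sqrt (2 * pi) ^ CARD('d))
        * (of_real (gauss z) * (g \<omega> * cnj (h (\<omega> - s *\<^sub>R z)))))"
      unfolding K_def gauss_scaled(2)[OF s] by (simp add: mult_ac)
    finally show "(LINT \<eta>|lborel. g \<omega> * cnj (h \<eta>) * K (\<omega> - \<eta>)) = (LINT z|lborel. of_real (sqrt (2 * pi) ^ CARD('d))
        * (of_real (gauss z) * (g \<omega> * cnj (h (\<omega> - s *\<^sub>R z)))))" .
  qed
  also have "\<dots> = of_real (sqrt (2 * pi) ^ CARD('d))
      * (LINT \<omega>|lborel. (LINT z|lborel. of_real (gauss z) * (g \<omega> * cnj (h (\<omega> - s *\<^sub>R z)))))"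
    by simp
  also have "(LINT \<omega>|lborel. (LINT z|lborel. of_real (gauss z) * (g \<omega> * cnj (h (\<omega> - s *\<^sub>R z)))))
      = (LINT z|lborel. (LINT \<omega>|lborel. of_real (gauss z) * (g \<omega> * cnj (h (\<omega> - s *\<^sub>R z)))))"
  proof -
    have "integrable (lborel \<Otimes>\<^sub>M lborel) (\<lambda>(z, \<omega>). of_real (gauss z) * (g \<omega> * cnj (h (\<omega> - s *\<^sub>R z))))"
    proof (rule lborel_pair.Fubini_integrable)
      show "(\<lambda>(z, \<omega>). of_real (gauss z) * (g \<omega> * cnj (h (\<omega> - s *\<^sub>R z)))) \<in> borel_measurable (lborel \<Otimes>\<^sub>M lborel)"
        by measurable
      show "AE z in lborel. integrable lborel (\<lambda>\<omega>. case (z, \<omega>) of (z, \<omega>) \<Rightarrow> of_real (gauss z) * (g \<omega> * cnj (h (\<omega> - s *\<^sub>R z))))"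
        using L2_mult_integrable[OF g(2) L2_translate[OF h(2)]] by auto
      show "integrable lborel (\<lambda>z. LINT \<omega>|lborel. norm (case (z, \<omega>) of (z, \<omega>) \<Rightarrow> of_real (gauss z) * (g \<omega> * cnj (h (\<omega> - s *\<^sub>R z)))))"
      proof (rule Bochner_Integration.integrable_bound)
        show "integrable lborel (\<lambda>z::real^'d. gauss z * ((L2_norm g)\<^sup>2 + (L2_norm h)\<^sup>2))"
          by (intro integrable_mult_left gauss_integrable)
        show "(\<lambda>z. LINT \<omega>|lborel. norm (case (z, \<omega>) of (z, \<omega>) \<Rightarrow> of_real (gauss z) * (g \<omega> * cnj (h (\<omega> - s *\<^sub>R z)))))
            \<in> borel_measurable lborel"
          by measurable
        show "AE z in lborel. norm (LINT \<omega>|lborel. norm (case (z, \<omega>) of (z, \<omega>) \<Rightarrow> of_real (gauss z) * (g \<omega> * cnj (h (\<omega> - s *\<^sub>R z)))))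
            \<le> norm (gauss z * ((L2_norm g)\<^sup>2 + (L2_norm h)\<^sup>2))"
        proof (rule AE_I2)
          fix z :: "real^'d"
          let ?h = "\<lambda>\<omega>. h (\<omega> - s *\<^sub>R z)"
          note hz = L2_translate[OF h(2), of "s *\<^sub>R z"]
          have "(LINT \<omega>|lborel. cmod (g \<omega>) * cmod (?h \<omega>)) \<le> (LINT \<omega>|lborel. (cmod (g \<omega>))\<^sup>2 + (cmod (?h \<omega>))\<^sup>2)"
            using L2_mult_integrable_real[OF g(2) hz] L2_D(2)[OF g(2)] L2_D(2)[OF hz]
            by (intro integral_mono mult_le_sum_power2) auto
          also have "\<dots> = (L2_norm g)\<^sup>2 + (L2_norm ?h)\<^sup>2"
            using L2_D(2)[OF g(2)] L2_D(2)[OF hz] by (simp add: L2_norm_power2)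
          finally have "gauss z * (LINT \<omega>|lborel. cmod (g \<omega>) * cmod (?h \<omega>))
              \<le> gauss z * ((L2_norm g)\<^sup>2 + (L2_norm h)\<^sup>2)"
            unfolding L2_norm_translate[OF h(2)] by (intro mult_left_mono) (auto simp: gauss_def)
          moreover have "0 \<le> gauss z * (LINT \<omega>|lborel. cmod (g \<omega>) * cmod (?h \<omega>))"
            by (simp add: gauss_def)
          moreover have "\<bar>gauss z\<bar> = gauss z" by (simp add: gauss_def)
          ultimately show "norm (LINT \<omega>|lborel. norm (case (z, \<omega>) of (z, \<omega>) \<Rightarrow> of_real (gauss z) * (g \<omega> * cnj (h (\<omega> - s *\<^sub>R z)))))
              \<le> norm (gauss z * ((L2_norm g)\<^sup>2 + (L2_norm h)\<^sup>2))"
            by (simp add: norm_mult)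
        qed
      qed
    qed
    from lborel_pair.Fubini_integral[OF this] show ?thesis by simp
  qed
  finally show ?thesis by (simp add: L2_inner_def)
qed

text \<open>
  The translates by \<open>s z\<close> converge in the mean for each \<open>z\<close>, and their inner products are dominated by
  \<open>\<parallel>g\<parallel> \<parallel>h\<parallel>\<close>. The constant \<open>(2\<pi>)\<^sup>d\<close> is the square of the mass of the Gaussian: one factor
  comes from its Fourier transform, the other from its integral.
\<close>
lemma Plancherel_gauss_tendsto:
  fixes g h :: "real^'d \<Rightarrow> complex"
  assumes g: "integrable lborel g" "g \<in> L2" and h: "integrable lborel h" "h \<in> L2"
  shows "(\<lambda>n. LINT x|lborel. of_real (gauss (inverse (real (Suc n)) *\<^sub>R x)) * (fourier_integral g x * cnj (fourier_integral h x)))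
    \<longlonglongrightarrow> of_real ((2 * pi) ^ CARD('d)) * L2_inner g h"
proof -
  note [measurable] = L2_D(1)[OF g(2)] L2_D(1)[OF h(2)]
  let ?s = "\<lambda>n. inverse (real (Suc n))"
  have A_meas [measurable]: "(\<lambda>z. L2_inner g (\<lambda>\<omega>. h (\<omega> - ?s n *\<^sub>R z))) \<in> borel_measurable borel" for n
    unfolding L2_inner_def by measurable
  have "(\<lambda>n. LINT z|lborel. of_real (gauss z) * L2_inner g (\<lambda>\<omega>. h (\<omega> - ?s n *\<^sub>R z)))
      \<longlonglongrightarrow> (LINT z|lborel. of_real (gauss (z :: real^'d)) * L2_inner g h)"
  proof (rule integral_dominated_convergence)
    show "integrable lborel (\<lambda>z :: real^'d. gauss z * (L2_norm g * L2_norm h))"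
      by (intro integrable_mult_left gauss_integrable)
    show "AE z in lborel. (\<lambda>n. of_real (gauss z) * L2_inner g (\<lambda>\<omega>. h (\<omega> - ?s n *\<^sub>R z)))
        \<longlonglongrightarrow> of_real (gauss z) * L2_inner g h"
    proof (intro AE_I2 tendsto_mult tendsto_const L2_inner_translate_tendsto g h)
      fix z :: "real^'d"
      have "(\<lambda>n. ?s n *\<^sub>R z) \<longlonglongrightarrow> 0 *\<^sub>R z"
        by (intro tendsto_intros LIMSEQ_inverse_real_of_nat)
      then show "(\<lambda>n. ?s n *\<^sub>R z) \<longlonglongrightarrow> 0" by simp
    qed
    show "AE z in lborel. norm (of_real (gauss z) * L2_inner g (\<lambda>\<omega>. h (\<omega> - ?s n *\<^sub>R z)))
        \<le> gauss z * (L2_norm g * L2_norm h)" for n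
      using L2_Cauchy_Schwarz[OF g(2) L2_translate[OF h(2)]]
      unfolding L2_norm_translate[OF h(2)]
      by (auto simp: norm_mult gauss_def)
  qed measurable
  also have "(LINT z|lborel. of_real (gauss (z :: real^'d)) * L2_inner g h)
      = of_real (sqrt (2 * pi) ^ CARD('d)) * L2_inner g h"
    using integral_complex_of_real[of lborel "gauss :: real^'d \<Rightarrow> real"]
    by (simp add: gauss_integral)
  finally have "(\<lambda>n. of_real (sqrt (2 * pi) ^ CARD('d)) * (LINT z|lborel. of_real (gauss z) * L2_inner g (\<lambda>\<omega>. h (\<omega> - ?s n *\<^sub>R z))))
      \<longlonglongrightarrow> of_real (sqrt (2 * pi) ^ CARD('d)) * (of_real (sqrt (2 * pi) ^ CARD('d)) * L2_inner g h)"
    by (rule tendsto_mult_left)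
  moreover have "of_real (sqrt (2 * pi) ^ CARD('d)) * (of_real (sqrt (2 * pi) ^ CARD('d)) * c)
      = of_real ((2 * pi) ^ CARD('d)) * c" for c :: complex
    unfolding mult.assoc[symmetric] of_real_mult[symmetric] power_mult_distrib[symmetric] by simp
  ultimately show ?thesis
    by (simp only: Plancherel_gauss[OF g h, of "?s _"] positive_imp_inverse_positive of_nat_0_less_iff zero_less_Suc)
qed

lemma gauss_le_1: "0 \<le> gauss x" "gauss x \<le> 1"
  by (simp_all add: gauss_def)

lemma gauss_tendsto: "(\<lambda>n. gauss (inverse (real (Suc n)) *\<^sub>R x)) \<longlonglongrightarrow> 1"
proof -
  have "(\<lambda>n. exp (- (norm (inverse (real (Suc n)) *\<^sub>R x))\<^sup>2 / 2)) \<longlonglongrightarrow> exp (- (norm (0 *\<^sub>R x))\<^sup>2 / 2)"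
    by (intro tendsto_intros LIMSEQ_inverse_real_of_nat) simp
  then show ?thesis by (simp add: gauss_def)
qed

text \<open>
  Fatou's lemma applied to the damped integrals of \<open>|fourier_integral g|\<^sup>2\<close>, which converge by the
  preceding limit.
\<close>
lemma fourier_integral_L2:
  fixes g :: "real^'d \<Rightarrow> complex"
  assumes g: "integrable lborel g" "g \<in> L2"
  shows "fourier_integral g \<in> L2"
proof -
  note [measurable] = L2_D(1)[OF g(2)]
  let ?s = "\<lambda>n. inverse (real (Suc n))"
  let ?c = "(2 * pi) ^ CARD('d) * (L2_norm g)\<^sup>2"
  define J where "J n = (LINT x|lborel. gauss (?s n *\<^sub>R x) * (cmod (fourier_integral g x))\<^sup>2)" for n
  have J_eq: "(LINT x|lborel. of_real (gauss (?s n *\<^sub>R x)) * (fourier_integral g x * cnj (fourier_integral g x))) = complex_of_real (J n)" for n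
    unfolding J_def integral_complex_of_real[symmetric]
    by (simp only: of_real_mult complex_norm_square)
  have "(\<lambda>n. complex_of_real (J n)) \<longlonglongrightarrow> of_real ?c"
    using Plancherel_gauss_tendsto[OF g g] unfolding J_eq L2_inner_self by simp
  then have J_lim: "J \<longlonglongrightarrow> ?c" by (simp only: tendsto_of_real_iff)
  have fourier_integral_bound: "cmod (fourier_integral g x) \<le> (LINT \<omega>|lborel. cmod (g \<omega>))" for x
    unfolding fourier_integral_def by (rule order_trans[OF integral_norm_bound]) (simp add: norm_mult)
  have int: "integrable lborel (\<lambda>x. gauss (?s n *\<^sub>R x) * (cmod (fourier_integral g x))\<^sup>2)" for n
  proof (rule Bochner_Integration.integrable_bound)
    show "integrable lborel (\<lambda>x :: real^'d. (LINT \<omega>|lborel. cmod (g \<omega>))\<^sup>2 * norm (complex_of_real (gauss (?s n *\<^sub>R x))))"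
      by (intro integrable_mult_right integrable_norm gauss_scaled(1)) simp
    show "AE x in lborel. norm (gauss (?s n *\<^sub>R x) * (cmod (fourier_integral g x))\<^sup>2)
        \<le> norm ((LINT \<omega>|lborel. cmod (g \<omega>))\<^sup>2 * norm (complex_of_real (gauss (?s n *\<^sub>R x))))"
    proof (rule AE_I2)
      fix x
      have "gauss (?s n *\<^sub>R x) * (cmod (fourier_integral g x))\<^sup>2 \<le> gauss (?s n *\<^sub>R x) * (LINT \<omega>|lborel. cmod (g \<omega>))\<^sup>2"
        by (intro mult_left_mono power_mono fourier_integral_bound) (auto simp: gauss_le_1)
      then show "norm (gauss (?s n *\<^sub>R x) * (cmod (fourier_integral g x))\<^sup>2)
          \<le> norm ((LINT \<omega>|lborel. cmod (g \<omega>))\<^sup>2 * norm (complex_of_real (gauss (?s n *\<^sub>R x))))"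
        by (simp only: real_norm_def abs_mult norm_of_real abs_power2 abs_of_nonneg[OF gauss_le_1(1)] abs_norm_cancel power2_abs mult.commute)
    qed
  qed measurable
  have nn: "(\<integral>\<^sup>+x. ennreal (gauss (?s n *\<^sub>R x) * (cmod (fourier_integral g x))\<^sup>2) \<partial>lborel) = ennreal (J n)" for n
    unfolding J_def by (rule nn_integral_eq_integral[OF int]) (simp add: gauss_le_1)
  have "(\<integral>\<^sup>+x. ennreal ((cmod (fourier_integral g x))\<^sup>2) \<partial>lborel)
      = (\<integral>\<^sup>+x. liminf (\<lambda>n. ennreal (gauss (?s n *\<^sub>R x) * (cmod (fourier_integral g x))\<^sup>2)) \<partial>lborel)"
  proof (rule nn_integral_cong)
    fix x
    have "(\<lambda>n. gauss (?s n *\<^sub>R x) * (cmod (fourier_integral g x))\<^sup>2) \<longlonglongrightarrow> 1 * (cmod (fourier_integral g x))\<^sup>2"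
      by (intro tendsto_intros gauss_tendsto)
    then have "(\<lambda>n. ennreal (gauss (?s n *\<^sub>R x) * (cmod (fourier_integral g x))\<^sup>2)) \<longlonglongrightarrow> ennreal ((cmod (fourier_integral g x))\<^sup>2)"
      by (intro tendsto_ennrealI) simp
    then show "ennreal ((cmod (fourier_integral g x))\<^sup>2) = liminf (\<lambda>n. ennreal (gauss (?s n *\<^sub>R x) * (cmod (fourier_integral g x))\<^sup>2))"
      by (simp add: lim_imp_Liminf)
  qed
  also have "\<dots> \<le> liminf (\<lambda>n. \<integral>\<^sup>+x. ennreal (gauss (?s n *\<^sub>R x) * (cmod (fourier_integral g x))\<^sup>2) \<partial>lborel)"
    by (rule nn_integral_liminf) measurable
  also have "\<dots> = ennreal ?c"
    unfolding nn using J_lim by (intro lim_imp_Liminf tendsto_ennrealI) auto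
  finally have "integrable lborel (\<lambda>x. (cmod (fourier_integral g x))\<^sup>2)"
    by (intro integrableI_bounded) (auto intro: order_le_less_trans)
  then show ?thesis by (simp add: L2_def)
qed

text \<open>
  Since both Fourier integrals are square-integrable, the damping can be removed by dominated
  convergence.
\<close>
theorem Plancherel:
  fixes g h :: "real^'d \<Rightarrow> complex"
  assumes g: "integrable lborel g" "g \<in> L2" and h: "integrable lborel h" "h \<in> L2"
  shows "L2_inner (fourier_integral g) (fourier_integral h) = of_real ((2 * pi) ^ CARD('d)) * L2_inner g h"
proof -
  note [measurable] = L2_D(1)[OF g(2)] L2_D(1)[OF h(2)]
  let ?s = "\<lambda>n. inverse (real (Suc n))"
  have "(\<lambda>n. LINT x|lborel. of_real (gauss (?s n *\<^sub>R x)) * (fourier_integral g x * cnj (fourier_integral h x)))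
    \<longlonglongrightarrow> (LINT x|lborel. fourier_integral g x * cnj (fourier_integral h x))"
  proof (rule integral_dominated_convergence)
    show "integrable lborel (\<lambda>x. cmod (fourier_integral g x) * cmod (fourier_integral h x))"
      by (intro L2_mult_integrable_real fourier_integral_L2 g h)
    show "AE x in lborel. (\<lambda>n. of_real (gauss (?s n *\<^sub>R x)) * (fourier_integral g x * cnj (fourier_integral h x))) \<longlonglongrightarrow> fourier_integral g x * cnj (fourier_integral h x)"
    proof (rule AE_I2)
      fix x
      have "(\<lambda>n. of_real (gauss (?s n *\<^sub>R x)) * (fourier_integral g x * cnj (fourier_integral h x))) \<longlonglongrightarrow> of_real 1 * (fourier_integral g x * cnj (fourier_integral h x))"
        by (intro tendsto_intros gauss_tendsto)
      then show "(\<lambda>n. of_real (gauss (?s n *\<^sub>R x)) * (fourier_integral g x * cnj (fourier_integral h x))) \<longlonglongrightarrow> fourier_integral g x * cnj (fourier_integral h x)"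
        by simp
    qed
    show "AE x in lborel. norm (of_real (gauss (?s n *\<^sub>R x)) * (fourier_integral g x * cnj (fourier_integral h x))) \<le> cmod (fourier_integral g x) * cmod (fourier_integral h x)" for n
      by (auto simp: norm_mult gauss_le_1 intro!: mult_left_le_one_le)
  qed measurable
  then show ?thesis
    using LIMSEQ_unique[OF _ Plancherel_gauss_tendsto[OF g h]] by (simp add: L2_inner_def)
qed

corollary Plancherel_norm:
  fixes g :: "real^'d \<Rightarrow> complex"
  assumes g: "integrable lborel g" "g \<in> L2"
  shows "(L2_norm (fourier_integral g))\<^sup>2 = (2 * pi) ^ CARD('d) * (L2_norm g)\<^sup>2"
proof -
  have "complex_of_real ((L2_norm (fourier_integral g))\<^sup>2) = of_real ((2 * pi) ^ CARD('d) * (L2_norm g)\<^sup>2)"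
    unfolding L2_inner_self[symmetric] Plancherel[OF g g] by (simp add: L2_inner_self)
  then show ?thesis by (simp only: of_real_eq_iff)
qed

section \<open>Bandlimited functions as Fourier integrals\<close>

abbreviation trunc :: "(real^'d \<Rightarrow> complex) \<Rightarrow> real \<Rightarrow> real^'d \<Rightarrow> complex" where
  "trunc f R \<equiv> \<lambda>x. indicator (cball 0 R) x * f x"

lemma trunc_L2: "f \<in> L2 \<Longrightarrow> trunc f R \<in> L2"
  by (rule L2_indicator) auto

lemma L2_cnj: "f \<in> L2 \<Longrightarrow> (\<lambda>x. cnj (f x)) \<in> L2"
  by (auto simp: L2_def)

lemma L2_norm_cnj [simp]: "L2_norm (\<lambda>x. cnj (f x)) = L2_norm f"
  by (simp add: L2_norm_def)

lemma trunc_integrable: "f \<in> L2 \<Longrightarrow> integrable lborel (trunc f R)"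
  by (rule L2_bounded_support_integrable[OF trunc_L2, where R=R]) auto

lemma fourier_trunc_eq:
  "fourier_trunc f R = (\<lambda>\<omega>. cnj (fourier_integral (\<lambda>x. cnj (trunc f R x)) \<omega>))"
proof
  fix \<omega>
  have "cnj (fourier_integral (\<lambda>x. cnj (trunc f R x)) \<omega>) = (LINT x|lborel. cnj (cnj (trunc f R x) * iexp (x \<bullet> \<omega>)))"
    unfolding fourier_integral_def by (rule Bochner_Integration.integral_cnj[symmetric])
  also have "\<dots> = fourier_trunc f R \<omega>"
    unfolding fourier_trunc_def set_lebesgue_integral_def
    by (intro Bochner_Integration.integral_cong refl)
      (simp add: exp_cnj inner_commute indicator_def)
  finally show "fourier_trunc f R \<omega> = cnj (fourier_integral (\<lambda>x. cnj (trunc f R x)) \<omega>)" ..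
qed

lemma fourier_trunc_L2:
  assumes "f \<in> L2" shows "fourier_trunc f R \<in> L2"
  unfolding fourier_trunc_eq
  by (intro L2_cnj fourier_integral_L2 integrable_cnj trunc_integrable trunc_L2 assms)

text \<open>
  The truncated transform is, up to conjugations, the Fourier integral of the integrable function
  \<open>trunc f R\<close>, so the Plancherel theorem applies to it.
\<close>
lemma fourier_trunc_norm:
  fixes f :: "real^'d \<Rightarrow> complex"
  assumes f: "f \<in> L2"
  shows "(L2_norm (fourier_trunc f R))\<^sup>2 = (2 * pi) ^ CARD('d) * (L2_norm (trunc f R))\<^sup>2"
  using Plancherel_norm[OF integrable_cnj[OF trunc_integrable[OF f]] L2_cnj[OF trunc_L2[OF f]]]
  unfolding fourier_trunc_eq L2_norm_cnj .

lemma trunc_norm_tendsto: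
  fixes f :: "real^'d \<Rightarrow> complex"
  assumes f: "f \<in> L2"
  shows "((\<lambda>R. (L2_norm (trunc f R))\<^sup>2) \<longlongrightarrow> (L2_norm f)\<^sup>2) at_top"
  unfolding L2_norm_power2
proof (rule integral_dominated_convergence_at_top)
  show "(\<lambda>x. (cmod (f x))\<^sup>2) \<in> borel_measurable lborel"
    by (rule borel_measurable_integrable[OF L2_D(2)[OF f]])
  show "(\<lambda>x. (cmod (trunc f R x))\<^sup>2) \<in> borel_measurable lborel" for R
    by (rule borel_measurable_integrable[OF L2_D(2)[OF trunc_L2[OF f]]])
  show "integrable lborel (\<lambda>x. (cmod (f x))\<^sup>2)" by (rule L2_D[OF f])
  show "AE x in lborel. ((\<lambda>R. (cmod (trunc f R x))\<^sup>2) \<longlongrightarrow> (cmod (f x))\<^sup>2) at_top"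
  proof (intro AE_I2 tendsto_eventually)
    show "\<forall>\<^sub>F R in at_top. (cmod (trunc f R x))\<^sup>2 = (cmod (f x))\<^sup>2" for x
      using eventually_ge_at_top[of "norm x"] by eventually_elim simp
  qed
  show "\<forall>\<^sub>F R in at_top. AE x in lborel. norm ((cmod (trunc f R x))\<^sup>2) \<le> (cmod (f x))\<^sup>2"
    by (auto simp: indicator_def)
qed

lemma fourier_integral_multiplication_formula:
  fixes a b :: "real^'d \<Rightarrow> complex"
  assumes a: "integrable lborel a" and b: "integrable lborel b"
  shows "(LINT x|lborel. fourier_integral a x * b x) = (LINT \<omega>|lborel. a \<omega> * fourier_integral b \<omega>)"
proof -
  note [measurable] = borel_measurable_integrable[OF a] borel_measurable_integrable[OF b]
  have int: "integrable (lborel \<Otimes>\<^sub>M lborel) (\<lambda>(\<omega>, x). (a \<omega> * b x) * iexp (\<omega> \<bullet> x))"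
  proof (rule Bochner_Integration.integrable_bound[OF integrable_pair_mult[OF a b]])
    show "(\<lambda>(\<omega>, x). (a \<omega> * b x) * iexp (\<omega> \<bullet> x)) \<in> borel_measurable (lborel \<Otimes>\<^sub>M lborel)" by measurable
  qed (auto simp: norm_mult)
  have 1: "fourier_integral a x * b x = (LINT \<omega>|lborel. (a \<omega> * b x) * iexp (\<omega> \<bullet> x))" for x
  proof -
    have "(LINT \<omega>|lborel. (a \<omega> * b x) * iexp (\<omega> \<bullet> x)) = (LINT \<omega>|lborel. (a \<omega> * iexp (\<omega> \<bullet> x)) * b x)"
      by (simp add: mult_ac)
    then show ?thesis by (simp only: fourier_integral_def integral_mult_left_zero)
  qed
  have 2: "a \<omega> * fourier_integral b \<omega> = (LINT x|lborel. (a \<omega> * b x) * iexp (\<omega> \<bullet> x))" for \<omega>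
    unfolding fourier_integral_def mult.assoc by (simp only: integral_mult_right_zero inner_commute)
  show ?thesis unfolding 1 2 by (rule lborel_pair.Fubini_integral[OF int])
qed

text \<open>
  Fourier inversion. Write \<open>f\<close> for the Fourier integral of \<open>g\<close>, \<open>c = (2\<pi>)\<^sup>d\<close> and expand the square of
  the distance from the truncated transform \<open>F\<^sub>R\<close> of \<open>f\<close> to \<open>c g\<close>. Here \<open>\<parallel>F\<^sub>R\<parallel>\<^sup>2\<close> is \<open>c\<close> times the squared norm
  of \<open>f\<close> on the ball of radius \<open>R\<close>, the multiplication formula gives the same value for the inner
  product of \<open>F\<^sub>R\<close> with \<open>c g\<close>, and \<open>\<parallel>c g\<parallel>\<^sup>2 = c \<parallel>f\<parallel>\<^sup>2\<close>. So the squared distance is \<open>c\<close> times the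
  squared norm of \<open>f\<close> outside the ball.
\<close>
lemma has_fourier_transform_fourier_integral:
  fixes g :: "real^'d \<Rightarrow> complex"
  assumes g: "integrable lborel g" "g \<in> L2"
  shows "has_fourier_transform (fourier_integral g) (\<lambda>\<omega>. of_real ((2 * pi) ^ CARD('d)) * g \<omega>)"
proof -
  define c :: real where "c = (2 * pi) ^ CARD('d)"
  define G where "G \<omega> = of_real c * g \<omega>" for \<omega>
  have c: "0 < c" by (simp add: c_def)
  have G: "G \<in> L2" unfolding G_def[abs_def] by (rule L2_cmult[OF g(2)])
  let ?f = "fourier_integral g"
  note f = fourier_integral_L2[OF g]
  have G_norm: "(L2_norm G)\<^sup>2 = c * (L2_norm ?f)\<^sup>2"
    using Plancherel_norm[OF g] c unfolding G_def[abs_def] L2_norm_cmult c_def[symmetric]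
    by (simp add: power_mult_distrib power2_eq_square)
  have inner: "Re (L2_inner (fourier_trunc ?f R) G) = c * (L2_norm (trunc ?f R))\<^sup>2" for R
  proof -
    have "cnj (L2_inner (fourier_trunc ?f R) G) = (LINT \<omega>|lborel. cnj (fourier_trunc ?f R \<omega> * cnj (G \<omega>)))"
      unfolding L2_inner_def by (rule Bochner_Integration.integral_cnj[symmetric])
    also have "\<dots> = of_real c * (LINT \<omega>|lborel. fourier_integral (\<lambda>x. cnj (trunc ?f R x)) \<omega> * g \<omega>)"
      unfolding fourier_trunc_eq G_def by (simp add: mult_ac flip: integral_mult_right_zero)
    also have "(LINT \<omega>|lborel. fourier_integral (\<lambda>x. cnj (trunc ?f R x)) \<omega> * g \<omega>)
        = (LINT x|lborel. cnj (trunc ?f R x) * ?f x)"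
      by (intro fourier_integral_multiplication_formula integrable_cnj trunc_integrable f g)
    also have "\<dots> = L2_inner (trunc ?f R) (trunc ?f R)"
      unfolding L2_inner_def
      by (intro Bochner_Integration.integral_cong refl) (simp add: indicator_def)
    also have "of_real c * \<dots> = of_real (c * (L2_norm (trunc ?f R))\<^sup>2)"
      by (simp add: L2_inner_self)
    finally have "Re (cnj (L2_inner (fourier_trunc ?f R) G)) = c * (L2_norm (trunc ?f R))\<^sup>2"
      by (simp only: Re_complex_of_real)
    then show ?thesis by simp
  qed
  have nn: "(\<integral>\<^sup>+ \<omega>. ennreal ((cmod (fourier_trunc ?f R \<omega> - G \<omega>))\<^sup>2) \<partial>lborel)
      = ennreal (c * (L2_norm ?f)\<^sup>2 - c * (L2_norm (trunc ?f R))\<^sup>2)" for R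
  proof -
    have "(\<integral>\<^sup>+ \<omega>. ennreal ((cmod (fourier_trunc ?f R \<omega> - G \<omega>))\<^sup>2) \<partial>lborel)
        = ennreal ((L2_norm (\<lambda>\<omega>. fourier_trunc ?f R \<omega> - G \<omega>))\<^sup>2)"
      unfolding L2_norm_power2
      by (intro nn_integral_eq_integral L2_D(2) L2_diff fourier_trunc_L2 f G) simp
    also have "(L2_norm (\<lambda>\<omega>. fourier_trunc ?f R \<omega> - G \<omega>))\<^sup>2
        = c * (L2_norm ?f)\<^sup>2 - c * (L2_norm (trunc ?f R))\<^sup>2"
      unfolding L2_norm_diff_power2[OF fourier_trunc_L2[OF f] G] inner G_norm
        fourier_trunc_norm[OF f] c_def[symmetric] by simp
    finally show ?thesis .
  qed
  have "((\<lambda>R. c * (L2_norm ?f)\<^sup>2 - c * (L2_norm (trunc ?f R))\<^sup>2)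
      \<longlongrightarrow> c * (L2_norm ?f)\<^sup>2 - c * (L2_norm ?f)\<^sup>2) at_top"
    by (intro tendsto_intros trunc_norm_tendsto f)
  then have "((\<lambda>R. ennreal (c * (L2_norm ?f)\<^sup>2 - c * (L2_norm (trunc ?f R))\<^sup>2)) \<longlongrightarrow> ennreal 0) at_top"
    by (intro tendsto_ennrealI) simp
  then have "has_fourier_transform ?f G"
    using G unfolding has_fourier_transform_def nn by simp
  then show ?thesis by (simp only: G_def[abs_def] c_def)
qed

text \<open>
  The truncated transforms of \<open>f - f'\<close> tend to \<open>0\<close> in the mean, and by the Plancherel theorem their
  norms tend to a multiple of \<open>\<parallel>f - f'\<parallel>\<close>.
\<close>
lemma fourier_transform_unique:
  fixes f f' :: "real^'d \<Rightarrow> complex"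
  assumes f: "f \<in> L2" "has_fourier_transform f g" and f': "f' \<in> L2" "has_fourier_transform f' g"
  shows "AE x in lborel. f x = f' x"
proof -
  define c :: real where "c = (2 * pi) ^ CARD('d)"
  have c: "0 < c" by (simp add: c_def)
  define u where "u x = f x - f' x" for x
  have u: "u \<in> L2" unfolding u_def[abs_def] by (intro L2_diff f f')
  note [measurable] = L2_D(1)[OF u] L2_D(1)[OF fourier_trunc_L2[OF f(1)]] L2_D(1)[OF fourier_trunc_L2[OF f'(1)]]
  have [measurable]: "g \<in> borel_measurable borel"
    using f(2) by (auto simp: has_fourier_transform_def L2_def)
  let ?e = "\<lambda>f R. \<integral>\<^sup>+ \<omega>. ennreal ((cmod (fourier_trunc f R \<omega> - g \<omega>))\<^sup>2) \<partial>lborel"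
  have lin: "fourier_trunc u R \<omega> = fourier_trunc f R \<omega> - fourier_trunc f' R \<omega>" for R \<omega>
  proof -
    have "(\<lambda>x. cnj (trunc u R x)) = (\<lambda>x. cnj (trunc f R x) - cnj (trunc f' R x))"
      by (auto simp: u_def algebra_simps)
    then have "fourier_integral (\<lambda>x. cnj (trunc u R x)) \<omega> = fourier_integral (\<lambda>x. cnj (trunc f R x)) \<omega> - fourier_integral (\<lambda>x. cnj (trunc f' R x)) \<omega>"
      using integrable_iexp_mult[OF integrable_cnj[OF trunc_integrable[OF f(1)]], of R \<omega>]
        integrable_iexp_mult[OF integrable_cnj[OF trunc_integrable[OF f'(1)]], of R \<omega>]
      by (simp add: fourier_integral_def left_diff_distrib)
    then show ?thesis by (simp add: fourier_trunc_eq)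
  qed
  have le: "ennreal (c * (L2_norm (trunc u R))\<^sup>2) \<le> 2 * ?e f R + 2 * ?e f' R" for R
  proof -
    have "ennreal (c * (L2_norm (trunc u R))\<^sup>2) = (\<integral>\<^sup>+ \<omega>. ennreal ((cmod (fourier_trunc u R \<omega>))\<^sup>2) \<partial>lborel)"
      unfolding c_def fourier_trunc_norm[OF u, symmetric] unfolding L2_norm_power2
      by (intro nn_integral_eq_integral[symmetric] L2_D(2) fourier_trunc_L2 u) simp
    also have "\<dots> \<le> (\<integral>\<^sup>+ \<omega>. 2 * ennreal ((cmod (fourier_trunc f R \<omega> - g \<omega>))\<^sup>2)
        + 2 * ennreal ((cmod (fourier_trunc f' R \<omega> - g \<omega>))\<^sup>2) \<partial>lborel)"
    proof (rule nn_integral_mono)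
      fix \<omega>
      have "(cmod (fourier_trunc u R \<omega>))\<^sup>2
          \<le> 2 * (cmod (fourier_trunc f R \<omega> - g \<omega>))\<^sup>2 + 2 * (cmod (fourier_trunc f' R \<omega> - g \<omega>))\<^sup>2"
        using cmod_add_power2_le[of "fourier_trunc f R \<omega> - g \<omega>" "g \<omega> - fourier_trunc f' R \<omega>"]
        by (simp add: lin norm_minus_commute)
      then have "ennreal ((cmod (fourier_trunc u R \<omega>))\<^sup>2)
          \<le> ennreal (2 * (cmod (fourier_trunc f R \<omega> - g \<omega>))\<^sup>2 + 2 * (cmod (fourier_trunc f' R \<omega> - g \<omega>))\<^sup>2)"
        by (rule ennreal_leI)
      then show "ennreal ((cmod (fourier_trunc u R \<omega>))\<^sup>2)
          \<le> 2 * ennreal ((cmod (fourier_trunc f R \<omega> - g \<omega>))\<^sup>2) + 2 * ennreal ((cmod (fourier_trunc f' R \<omega> - g \<omega>))\<^sup>2)"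
        by (simp add: ennreal_plus ennreal_mult)
    qed
    also have "\<dots> = 2 * ?e f R + 2 * ?e f' R"
      by (subst nn_integral_add) (auto simp: nn_integral_cmult)
    finally show ?thesis .
  qed
  have "((\<lambda>R. 2 * ?e f R + 2 * ?e f' R) \<longlongrightarrow> 2 * 0 + 2 * 0) at_top"
    using f(2) f'(2) unfolding has_fourier_transform_def
    by (intro tendsto_add ennreal_tendsto_cmult) auto
  then have lim0: "((\<lambda>R. 2 * ?e f R + 2 * ?e f' R) \<longlongrightarrow> 0) at_top" by simp
  have "((\<lambda>R. ennreal (c * (L2_norm (trunc u R))\<^sup>2)) \<longlongrightarrow> 0) at_top"
  proof (rule tendsto_sandwich[OF _ _ tendsto_const lim0])
    show "\<forall>\<^sub>F R in at_top. ennreal (c * (L2_norm (trunc u R))\<^sup>2) \<le> 2 * ?e f R + 2 * ?e f' R"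
      by (intro always_eventually allI le)
  qed simp
  moreover have "((\<lambda>R. ennreal (c * (L2_norm (trunc u R))\<^sup>2)) \<longlongrightarrow> ennreal (c * (L2_norm u)\<^sup>2)) at_top"
    by (intro tendsto_ennrealI tendsto_intros trunc_norm_tendsto u)
  ultimately have "ennreal (c * (L2_norm u)\<^sup>2) = 0"
    using tendsto_unique[OF trivial_limit_at_top_linorder] by blast
  then have "(L2_norm u)\<^sup>2 = 0" using c
    by (simp add: mult_le_0_iff)
  then have "AE x in lborel. (cmod (u x))\<^sup>2 = 0"
    unfolding L2_norm_power2 by (subst (asm) integral_nonneg_eq_0_iff_AE) (auto intro: L2_D(2)[OF u])
  then show ?thesis by (auto simp: u_def)
qed

text \<open>
  The functions whose Fourier integrals are the bandlimited functions. Vanishing outside \<open>\<Omega>\<close> is required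
  everywhere, not almost everywhere, which keeps multiplication by unbounded monomials harmless.
\<close>
definition spectra :: "(real^'d) set \<Rightarrow> (real^'d \<Rightarrow> complex) set" where
  "spectra \<Omega> = {g \<in> L2. \<forall>\<omega>. \<omega> \<notin> \<Omega> \<longrightarrow> g \<omega> = 0}"

lemma spectra_L2: "g \<in> spectra \<Omega> \<Longrightarrow> g \<in> L2"
  by (simp add: spectra_def)

lemma spectra_integrable:
  assumes "compact \<Omega>" "g \<in> spectra \<Omega>"
  shows "integrable lborel g"
proof -
  obtain R where R: "\<And>\<omega>. \<omega> \<in> \<Omega> \<Longrightarrow> norm \<omega> \<le> R"
    using compact_imp_bounded[OF assms(1)] by (auto simp: bounded_iff)
  show ?thesis
  proof (rule L2_bounded_support_integrable[where R=R])
    show "g \<omega> = 0" if "\<omega> \<notin> cball 0 R" for \<omega>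
      using R[of \<omega>] that assms(2) by (auto simp: spectra_def)
  qed (rule spectra_L2[OF assms(2)])
qed

lemma spectra_mult:
  assumes "compact \<Omega>" "g \<in> spectra \<Omega>" "continuous_on UNIV m"
  shows "(\<lambda>\<omega>. m \<omega> * g \<omega>) \<in> spectra \<Omega>"
proof -
  have "bounded (m ` \<Omega>)"
    using assms(1,3) compact_continuous_image continuous_on_subset compact_imp_bounded
    by (metis subset_UNIV)
  then obtain C where "\<And>\<omega>. \<omega> \<in> \<Omega> \<Longrightarrow> cmod (m \<omega>) \<le> C" by (auto simp: bounded_iff)
  then have "(\<lambda>\<omega>. m \<omega> * g \<omega>) \<in> L2"
    using assms(2,3)
    by (intro L2_bounded_mult[where C=C] borel_measurable_continuous_onI) (auto simp: spectra_def)
  then show ?thesis using assms(2) by (auto simp: spectra_def)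
qed

lemma norm_le_band_radius:
  assumes "compact \<Omega>" "\<omega> \<in> \<Omega>" shows "norm \<omega> \<le> band_radius \<Omega>"
  unfolding band_radius_def
  using assms compact_imp_bounded[OF assms(1)]
  by (auto intro!: cSUP_upper simp: bounded_iff bdd_above_def)

text \<open>
  The Taylor polynomial of \<open>h \<mapsto> e\<^bsup>i\<omega>\<cdot>h\<^esup>\<close> under the integral sign; on the band, \<open>|\<omega> \<cdot> h|\<close> is at most the
  radius of the band times \<open>|h|\<close>. With \<open>N = 1\<close> it yields the derivative of the Fourier integral, with
  \<open>N\<close> tending to infinity its Taylor series.
\<close>
lemma fourier_integral_Taylor_remainder:
  fixes g :: "real^'d \<Rightarrow> complex"
  assumes \<Omega>: "compact \<Omega>" and g: "g \<in> spectra \<Omega>"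
  shows "cmod (fourier_integral g (x + h) - (\<Sum>k\<le>N. fourier_integral (\<lambda>\<omega>. (\<i> * of_real (\<omega> \<bullet> h)) ^ k * g \<omega>) x / fact k))
    \<le> (LINT \<omega>|lborel. cmod (g \<omega>)) * ((band_radius \<Omega> * norm h) ^ Suc N / fact (Suc N))"
proof -
  let ?D = "\<lambda>k \<omega>. (\<i> * of_real (\<omega> \<bullet> h)) ^ k * g \<omega>"
  let ?T = "\<lambda>k \<omega>. ?D k \<omega> * iexp (\<omega> \<bullet> x) / fact k"
  let ?b = "(band_radius \<Omega> * norm h) ^ Suc N / fact (Suc N)"
  have D: "?D k \<in> spectra \<Omega>" for k
    by (intro spectra_mult \<Omega> g continuous_intros)
  have intD: "integrable lborel (?T k)" for k
    by (intro integrable_divide_zero integrable_iexp_mult spectra_integrable[OF \<Omega> D])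
  have intg: "integrable lborel (\<lambda>\<omega>. g \<omega> * iexp (\<omega> \<bullet> y))" for y
    by (intro integrable_iexp_mult spectra_integrable[OF \<Omega> g])
  have "(\<Sum>k\<le>N. fourier_integral (?D k) x / fact k) = (LINT \<omega>|lborel. (\<Sum>k\<le>N. ?T k \<omega>))"
    unfolding fourier_integral_def by (subst Bochner_Integration.integral_sum) (simp_all only: intD integral_divide_zero)
  then have "fourier_integral g (x + h) - (\<Sum>k\<le>N. fourier_integral (?D k) x / fact k)
      = (LINT \<omega>|lborel. g \<omega> * iexp (\<omega> \<bullet> (x + h)) - (\<Sum>k\<le>N. ?T k \<omega>))"
    unfolding fourier_integral_def[of g] using intD intg
    by (subst Bochner_Integration.integral_diff) auto
  also have "cmod \<dots> \<le> (LINT \<omega>|lborel. cmod (g \<omega>) * ?b)"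
  proof (rule Bochner_Integration.integral_norm_bound_integral)
    show "integrable lborel (\<lambda>\<omega>. g \<omega> * iexp (\<omega> \<bullet> (x + h)) - (\<Sum>k\<le>N. ?T k \<omega>))"
      by (intro Bochner_Integration.integrable_diff Bochner_Integration.integrable_sum intD intg)
    show "integrable lborel (\<lambda>\<omega>. cmod (g \<omega>) * ?b)"
      by (intro integrable_mult_left integrable_norm spectra_integrable[OF \<Omega> g])
    fix \<omega> :: "real^'d"
    show "cmod (g \<omega> * iexp (\<omega> \<bullet> (x + h)) - (\<Sum>k\<le>N. ?T k \<omega>)) \<le> cmod (g \<omega>) * ?b"
    proof (cases "\<omega> \<in> \<Omega>")
      case True
      have "iexp (\<omega> \<bullet> (x + h)) = iexp (\<omega> \<bullet> x) * iexp (\<omega> \<bullet> h)"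
        by (simp add: inner_add_right algebra_simps flip: exp_add)
      then have "g \<omega> * iexp (\<omega> \<bullet> (x + h)) - (\<Sum>k\<le>N. ?T k \<omega>)
          = g \<omega> * iexp (\<omega> \<bullet> x) * (iexp (\<omega> \<bullet> h) - (\<Sum>k\<le>N. (\<i> * of_real (\<omega> \<bullet> h)) ^ k / fact k))"
        by (simp add: right_diff_distrib sum_distrib_left mult_ac)
      then have "cmod (g \<omega> * iexp (\<omega> \<bullet> (x + h)) - (\<Sum>k\<le>N. ?T k \<omega>))
          = cmod (g \<omega>) * cmod (iexp (\<omega> \<bullet> h) - (\<Sum>k\<le>N. (\<i> * of_real (\<omega> \<bullet> h)) ^ k / fact k))"
        by (simp add: norm_mult)
      also have "\<dots> \<le> cmod (g \<omega>) * ?b"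
      proof (rule mult_left_mono)
        have "\<bar>\<omega> \<bullet> h\<bar> \<le> band_radius \<Omega> * norm h"
          using Cauchy_Schwarz_ineq2[of \<omega> h]
            mult_right_mono[OF norm_le_band_radius[OF \<Omega> True], of "norm h"] by simp
        then have "\<bar>\<omega> \<bullet> h\<bar> ^ Suc N / fact (Suc N) \<le> ?b"
          by (intro divide_right_mono power_mono) auto
        then show "cmod (iexp (\<omega> \<bullet> h) - (\<Sum>k\<le>N. (\<i> * of_real (\<omega> \<bullet> h)) ^ k / fact k)) \<le> ?b"
          using iexp_approx1[of "\<omega> \<bullet> h" N] by linarith
      qed simp
      finally show ?thesis .
    next
      case False
      then show ?thesis using g by (simp add: spectra_def)
    qed
  qed
  also have "\<dots> = (LINT \<omega>|lborel. cmod (g \<omega>)) * ?b" by (rule integral_mult_left_zero)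
  finally show ?thesis .
qed

lemma fourier_integral_has_derivative:
  fixes g :: "real^'d \<Rightarrow> complex"
  assumes \<Omega>: "compact \<Omega>" and g: "g \<in> spectra \<Omega>"
  shows "(fourier_integral g has_derivative (\<lambda>h. fourier_integral (\<lambda>\<omega>. \<i> * of_real (\<omega> \<bullet> h) * g \<omega>) x)) (at x)"
proof -
  let ?D = "\<lambda>h \<omega>. \<i> * of_real (\<omega> \<bullet> h) * g \<omega>"
  have "?D h \<in> spectra \<Omega>" for h
    by (intro spectra_mult \<Omega> g continuous_intros)
  note int = integrable_iexp_mult[OF spectra_integrable[OF \<Omega> this]]
  let ?C = "(LINT \<omega>|lborel. cmod (g \<omega>)) * ((band_radius \<Omega>)\<^sup>2 / 2)"
  have "linear (\<lambda>h. fourier_integral (?D h) x)"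
  proof (rule linearI)
    show "fourier_integral (?D (h + h')) x = fourier_integral (?D h) x + fourier_integral (?D h') x" for h h'
      using int[of h x] int[of h' x] by (simp add: fourier_integral_def inner_add_right algebra_simps)
    show "fourier_integral (?D (r *\<^sub>R h)) x = r *\<^sub>R fourier_integral (?D h) x" for r h
    proof -
      have "fourier_integral (?D (r *\<^sub>R h)) x = (LINT \<omega>|lborel. of_real r * (?D h \<omega> * iexp (\<omega> \<bullet> x)))"
        unfolding fourier_integral_def by (simp add: mult_ac)
      then show ?thesis by (simp only: fourier_integral_def integral_mult_right_zero scaleR_conv_of_real)
    qed
  qed
  then have lin: "bounded_linear (\<lambda>h. fourier_integral (?D h) x)" by (simp add: linear_conv_bounded_linear)
  have remainder: "cmod (fourier_integral g y - fourier_integral g x - fourier_integral (?D (y - x)) x) \<le> ?C * (norm (y - x))\<^sup>2" for y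
    using fourier_integral_Taylor_remainder[OF assms, of x "y - x" 1]
    by (simp add: power_mult_distrib power2_eq_square algebra_simps)
  show ?thesis
  proof (rule has_derivativeI_sandwich[where e=1 and H="\<lambda>y. ?C * norm (y - x)"])
    show "norm ((fourier_integral g y - fourier_integral g x) - fourier_integral (?D (y - x)) x) / norm (y - x) \<le> ?C * norm (y - x)"
      if "y \<noteq> x" for y
      using remainder[of y] that by (simp add: pos_divide_le_eq power2_eq_square)
    have "((\<lambda>y. ?C * norm (y - x)) \<longlongrightarrow> ?C * norm (x - x)) (at x)"
      by (intro tendsto_intros)
    then show "((\<lambda>y. ?C * norm (y - x)) \<longlongrightarrow> 0) (at x)" by simp
  qed (use lin in auto)
qed

lemma partial_diff_fourier_integral:
  fixes g :: "real^'d \<Rightarrow> complex"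
  assumes \<Omega>: "compact \<Omega>" and g: "g \<in> spectra \<Omega>"
  shows "partial_diff i (fourier_integral g) = fourier_integral (\<lambda>\<omega>. \<i> * of_real (\<omega> $ i) * g \<omega>)"
proof
  fix x :: "real^'d"
  have "((\<lambda>t::real. x + t *\<^sub>R axis i 1) has_vector_derivative axis i 1) (at 0)"
    by (auto intro!: derivative_eq_intros)
  moreover have "(fourier_integral g has_derivative (\<lambda>h. fourier_integral (\<lambda>\<omega>. \<i> * of_real (\<omega> \<bullet> h) * g \<omega>) x)) (at (x + 0 *\<^sub>R axis i 1))"
    using fourier_integral_has_derivative[OF assms, of x] by simp
  ultimately have "((fourier_integral g \<circ> (\<lambda>t. x + t *\<^sub>R axis i 1)) has_vector_derivative
      fourier_integral (\<lambda>\<omega>. \<i> * of_real (\<omega> \<bullet> axis i 1) * g \<omega>) x) (at 0)"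
    by (rule vector_derivative_diff_chain_within[OF _ has_derivative_at_withinI])
  then show "partial_diff i (fourier_integral g) x = fourier_integral (\<lambda>\<omega>. \<i> * of_real (\<omega> $ i) * g \<omega>) x"
    unfolding partial_diff_def by (simp add: vector_derivative_at o_def inner_axis)
qed

lemma smooth_fourier_integral:
  assumes \<Omega>: "compact \<Omega>" and g: "g \<in> spectra \<Omega>"
  shows "smooth (fourier_integral g)"
  unfolding smooth_def
proof
  fix "is"
  have "\<exists>g'\<in>spectra \<Omega>. foldr partial_diff is (fourier_integral g) = fourier_integral g'"
  proof (induction "is")
    case (Cons i "is")
    then obtain g' where g': "g' \<in> spectra \<Omega>" "foldr partial_diff is (fourier_integral g) = fourier_integral g'" by blast
    then have "foldr partial_diff (i # is) (fourier_integral g) = fourier_integral (\<lambda>\<omega>. \<i> * of_real (\<omega> $ i) * g' \<omega>)"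
      by (simp add: partial_diff_fourier_integral[OF \<Omega> g'(1)])
    moreover have "(\<lambda>\<omega>. \<i> * of_real (\<omega> $ i) * g' \<omega>) \<in> spectra \<Omega>"
      by (intro spectra_mult \<Omega> g' continuous_intros)
    ultimately show ?case by blast
  qed (use g in auto)
  then obtain g' where g': "g' \<in> spectra \<Omega>" "foldr partial_diff is (fourier_integral g) = fourier_integral g'" by blast
  show "foldr partial_diff is (fourier_integral g) differentiable_on UNIV"
    unfolding g'(2) differentiable_on_def differentiable_def
    using has_derivative_at_withinI[OF fourier_integral_has_derivative[OF \<Omega> g'(1)]] by blast
qed

text \<open>
  The monomial \<open>(i\<omega>)\<^sup>\<alpha>\<close>, the symbol of \<open>D\<^sup>\<alpha>\<close>.
\<close>
definition freq_power :: "nat^'d \<Rightarrow> real^'d \<Rightarrow> complex" where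
  "freq_power \<alpha> \<omega> = (\<Prod>i\<in>UNIV. (\<i> * of_real (\<omega> $ i)) ^ (\<alpha> $ i))"

lemma freq_power_cont: "continuous_on UNIV (freq_power \<alpha>)"
  unfolding freq_power_def by (intro continuous_intros)

lemma multi_diff_fourier_integral:
  fixes \<alpha> :: "nat^'d"
  assumes \<Omega>: "compact \<Omega>" and g: "g \<in> spectra \<Omega>"
  shows "multi_diff \<alpha> (fourier_integral g) = fourier_integral (\<lambda>\<omega>. freq_power \<alpha> \<omega> * g \<omega>)"
proof -
  have pow: "(partial_diff i ^^ n) (fourier_integral u) = fourier_integral (\<lambda>\<omega>. (\<i> * of_real (\<omega> $ i)) ^ n * u \<omega>)"
    if u: "u \<in> spectra \<Omega>" for u i n
  proof (induction n)
    case (Suc n)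
    have "(\<lambda>\<omega>. (\<i> * of_real (\<omega> $ i)) ^ n * u \<omega>) \<in> spectra \<Omega>"
      by (intro spectra_mult \<Omega> u continuous_intros)
    from partial_diff_fourier_integral[OF \<Omega> this, of i] show ?case by (simp add: Suc mult.assoc)
  qed simp
  have fold: "foldr (\<lambda>i. partial_diff i ^^ (\<alpha> $ i)) is (fourier_integral g)
      = fourier_integral (\<lambda>\<omega>. (\<Prod>i\<leftarrow>is. (\<i> * of_real (\<omega> $ i)) ^ (\<alpha> $ i)) * g \<omega>)" for "is"
  proof (induction "is")
    case (Cons i "is")
    have "(\<lambda>\<omega>. (\<Prod>i\<leftarrow>is. (\<i> * of_real (\<omega> $ i)) ^ (\<alpha> $ i)) * g \<omega>) \<in> spectra \<Omega>"
    proof (intro spectra_mult \<Omega> g)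
      show "continuous_on UNIV (\<lambda>\<omega>. \<Prod>i\<leftarrow>is. (\<i> * of_real (\<omega> $ i)) ^ (\<alpha> $ i))"
        by (induction "is") (auto intro!: continuous_intros)
    qed
    from pow[OF this, of "\<alpha> $ i" i] show ?case by (simp add: Cons mult.assoc)
  qed simp
  define xs :: "'d list" where "xs = (SOME is. distinct is \<and> set is = UNIV)"
  have xs: "distinct xs" "set xs = UNIV"
    using someI_ex[of "\<lambda>is :: 'd list. distinct is \<and> set is = UNIV"] finite_distinct_list[of "UNIV :: 'd set"]
    unfolding xs_def by auto
  have "(\<Prod>i\<leftarrow>xs. (\<i> * of_real (\<omega> $ i)) ^ (\<alpha> $ i)) = freq_power \<alpha> \<omega>" for \<omega> :: "real^'d"
    unfolding freq_power_def using prod.distinct_set_conv_list[OF xs(1)] xs(2) by metis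
  then show ?thesis
    unfolding multi_diff_def xs_def[symmetric] fold by simp
qed

text \<open>
  The complement of the essential support is a union of possibly uncountably many open sets on which
  \<open>g\<close> vanishes almost everywhere; by the Lindelof property countably many of them suffice.
\<close>
lemma AE_zero_outside_ess_support:
  assumes "ess_support g \<subseteq> \<Omega>"
  shows "AE \<omega> in lborel. \<omega> \<notin> \<Omega> \<longrightarrow> g \<omega> = 0"
proof -
  let ?U = "{U. open U \<and> (AE \<omega> in lborel. \<omega> \<in> U \<longrightarrow> g \<omega> = 0)}"
  obtain V where V: "V \<subseteq> ?U" "countable V" "\<Union>V = \<Union>?U"
    using Lindelof[of ?U] by blast
  have "AE \<omega> in lborel. \<forall>U\<in>V. \<omega> \<in> U \<longrightarrow> g \<omega> = 0"
    using V by (subst AE_ball_countable) auto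
  moreover have "- \<Omega> \<subseteq> \<Union>V" using assms unfolding V(3) ess_support_def by auto
  ultimately show ?thesis by (auto elim!: eventually_mono)
qed

lemma continuous_AE_eq:
  fixes f f' :: "real^'d \<Rightarrow> complex"
  assumes ae: "AE x in lborel. f x = f' x" and "continuous_on UNIV f" "continuous_on UNIV f'"
  shows "f = f'"
proof -
  have "open {x. f x \<noteq> f' x}" using assms(2,3) by (intro open_Collect_neq)
  moreover have "negligible {x. f x \<noteq> f' x}"
    unfolding negligible_iff_null_sets
    using AE_completion[OF ae] by (subst AE_iff_null_sets) (auto simp: \<open>open _\<close> intro: borel_open)
  ultimately show ?thesis using open_not_negligible by fastforce
qed

text \<open>
  From left to right, the Fourier transform of \<open>f\<close> can be changed on a null set so that it vanishes
  outside \<open>\<Omega>\<close>; its rescaled Fourier integral has the same transform as \<open>f\<close>, hence agrees with \<open>f\<close>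
  almost everywhere, hence everywhere by continuity.
\<close>
theorem bandlimited_eq:
  fixes \<Omega> :: "(real^'d) set"
  assumes \<Omega>: "compact \<Omega>"
  shows "bandlimited \<Omega> = fourier_integral ` spectra \<Omega>"
proof (intro set_eqI iffI)
  define c :: complex where "c = of_real ((2 * pi) ^ CARD('d))"
  have c: "c \<noteq> 0" by (simp add: c_def)
  fix f :: "real^'d \<Rightarrow> complex"
  assume "f \<in> bandlimited \<Omega>"
  then obtain g where f: "f \<in> L2" "smooth f" and g: "has_fourier_transform f g" "ess_support g \<subseteq> \<Omega>"
    by (auto simp: bandlimited_def)
  have gL2: "g \<in> L2" using g(1) by (simp add: has_fourier_transform_def)
  define g' where "g' = (\<lambda>\<omega>. indicator \<Omega> \<omega> * g \<omega>)"
  have \<Omega>_borel: "\<Omega> \<in> sets borel" using \<Omega> by (simp add: borel_compact)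
  have g'L2: "g' \<in> L2" unfolding g'_def by (rule L2_indicator[OF gL2 \<Omega>_borel])
  have ae: "AE \<omega> in lborel. g \<omega> = g' \<omega>"
    using AE_zero_outside_ess_support[OF g(2)] by eventually_elim (auto simp: g'_def indicator_def)
  have "(\<integral>\<^sup>+ \<omega>. ennreal ((cmod (fourier_trunc f R \<omega> - g' \<omega>))\<^sup>2) \<partial>lborel)
      = (\<integral>\<^sup>+ \<omega>. ennreal ((cmod (fourier_trunc f R \<omega> - g \<omega>))\<^sup>2) \<partial>lborel)" for R
    by (rule nn_integral_cong_AE) (use ae in eventually_elim, simp)
  then have ft: "has_fourier_transform f g'"
    using g(1) g'L2 by (simp add: has_fourier_transform_def)
  define u where "u = (\<lambda>\<omega>. inverse c * g' \<omega>)"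
  have u: "u \<in> spectra \<Omega>"
    unfolding u_def spectra_def using L2_cmult[OF g'L2, of "inverse c"] by (auto simp: g'_def)
  have "has_fourier_transform (fourier_integral u) (\<lambda>\<omega>. c * u \<omega>)"
    unfolding c_def by (rule has_fourier_transform_fourier_integral[OF spectra_integrable[OF \<Omega> u] spectra_L2[OF u]])
  then have "has_fourier_transform (fourier_integral u) g'" using c by (simp add: u_def mult.assoc[symmetric])
  then have "AE x in lborel. f x = fourier_integral u x"
    by (intro fourier_transform_unique[OF f(1) ft] fourier_integral_L2 spectra_integrable[OF \<Omega> u] spectra_L2[OF u])
  moreover have "continuous_on UNIV h" if "smooth h" for h :: "real^'d \<Rightarrow> complex"
    using that[unfolded smooth_def, rule_format, of "[]"] by (simp add: differentiable_imp_continuous_on)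
  ultimately have "f = fourier_integral u"
    using f(2) smooth_fourier_integral[OF \<Omega> u] by (intro continuous_AE_eq)
  then show "f \<in> fourier_integral ` spectra \<Omega>" using u by blast
next
  fix f assume "f \<in> fourier_integral ` spectra \<Omega>"
  then obtain g where g: "g \<in> spectra \<Omega>" "f = fourier_integral g" by blast
  let ?g = "\<lambda>\<omega>. of_real ((2 * pi) ^ CARD('d)) * g \<omega>"
  have "ess_support ?g \<subseteq> \<Omega>"
    using g(1) compact_imp_closed[OF \<Omega>]
    by (auto simp: ess_support_def spectra_def intro!: exI[of _ "- \<Omega>"])
  then show "f \<in> bandlimited \<Omega>"
    using has_fourier_transform_fourier_integral[OF spectra_integrable[OF \<Omega> g(1)] spectra_L2[OF g(1)]]
      smooth_fourier_integral[OF \<Omega> g(1)] fourier_integral_L2[OF spectra_integrable[OF \<Omega> g(1)] spectra_L2[OF g(1)]]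
    unfolding bandlimited_def g(2) by blast
qed

section \<open>Perturbation of the sampling points\<close>

lemma band_radius_nonneg:
  assumes "compact \<Omega>" shows "0 \<le> band_radius \<Omega>"
proof (cases "\<Omega> = {}")
  case False
  then obtain \<omega> where "\<omega> \<in> \<Omega>" by blast
  then show ?thesis using norm_le_band_radius[OF assms] norm_ge_zero order_trans by blast
qed (simp add: band_radius_def)

lemma fourier_integral_Taylor_sums:
  fixes g :: "real^'d \<Rightarrow> complex"
  assumes \<Omega>: "compact \<Omega>" and g: "g \<in> spectra \<Omega>"
  shows "(\<lambda>k. fourier_integral (\<lambda>\<omega>. (\<i> * of_real (\<omega> \<bullet> h)) ^ Suc k * g \<omega>) x / fact (Suc k)) sums (fourier_integral g (x + h) - fourier_integral g x)"
proof -
  let ?t = "\<lambda>k. fourier_integral (\<lambda>\<omega>. (\<i> * of_real (\<omega> \<bullet> h)) ^ k * g \<omega>) x / fact k"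
  let ?r = "band_radius \<Omega> * norm h"
  have "(\<lambda>N. ?r ^ N / fact N) \<longlonglongrightarrow> 0"
    using summable_LIMSEQ_zero[OF summable_exp[of ?r]] by (simp add: field_simps)
  then have "(\<lambda>N. ?r ^ Suc N / fact (Suc N)) \<longlonglongrightarrow> 0"
    by (rule LIMSEQ_Suc)
  then have "(\<lambda>N. (LINT \<omega>|lborel. cmod (g \<omega>)) * (?r ^ Suc N / fact (Suc N))) \<longlonglongrightarrow> 0"
    by (rule tendsto_mult_right_zero)
  then have "(\<lambda>N. fourier_integral g (x + h) - (\<Sum>k\<le>N. ?t k)) \<longlonglongrightarrow> 0"
    by (rule Lim_null_comparison[OF always_eventually, rotated])
      (intro allI fourier_integral_Taylor_remainder[OF \<Omega> g])
  then have "(\<lambda>N. fourier_integral g (x + h) - (fourier_integral g (x + h) - (\<Sum>k\<le>N. ?t k))) \<longlonglongrightarrow> fourier_integral g (x + h) - 0"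
    by (intro tendsto_intros)
  then have "?t sums fourier_integral g (x + h)" by (simp add: sums_def_le)
  then show ?thesis by (subst sums_Suc_iff) simp
qed

text \<open>
  The symbol of the iterated derivative along the coordinates \<open>p 0, \<dots>, p (j - 1)\<close>.
\<close>
definition freq_tuple :: "nat \<Rightarrow> (nat \<Rightarrow> 'd) \<Rightarrow> real^'d \<Rightarrow> complex" where
  "freq_tuple j p \<omega> = (\<Prod>l<j. \<i> * of_real (\<omega> $ p l))"

abbreviation tuples :: "nat \<Rightarrow> (nat \<Rightarrow> 'd) set" where
  "tuples j \<equiv> {..<j} \<rightarrow>\<^sub>E UNIV"

lemma freq_tuple_cont: "continuous_on UNIV (freq_tuple j p)"
  unfolding freq_tuple_def by (intro continuous_intros)

lemma power_sum_tuples: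
  fixes a :: "'d::finite \<Rightarrow> 'a::comm_semiring_1"
  shows "(\<Sum>i\<in>UNIV. a i) ^ j = (\<Sum>p\<in>tuples j. \<Prod>l<j. a (p l))"
  using prod_sum_PiE[of "{..<j}" "\<lambda>_. UNIV" "\<lambda>_. a"] by simp

lemma inner_power_eq_tuples:
  fixes \<omega> h :: "real^'d"
  shows "(\<i> * of_real (\<omega> \<bullet> h)) ^ j = (\<Sum>p\<in>tuples j. of_real (\<Prod>l<j. h $ p l) * freq_tuple j p \<omega>)"
proof -
  have "\<i> * of_real (\<omega> \<bullet> h) = (\<Sum>i\<in>UNIV. of_real (h $ i) * (\<i> * of_real (\<omega> $ i)))"
    by (simp add: inner_vec_def sum_distrib_left mult_ac)
  then show ?thesis
    by (simp add: power_sum_tuples prod.distrib freq_tuple_def)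
qed

lemma norm_power_eq_tuples:
  fixes h :: "real^'d"
  shows "(norm h) ^ (2 * j) = (\<Sum>p\<in>tuples j. (\<Prod>l<j. h $ p l)\<^sup>2)"
proof -
  have "(norm h)\<^sup>2 = (\<Sum>i\<in>UNIV. (h $ i)\<^sup>2)"
    unfolding power2_norm_eq_inner inner_vec_def by (simp add: power2_eq_square)
  then show ?thesis
    by (simp add: power_mult power_sum_tuples prod_power_distrib)
qed

text \<open>
  The \<open>j\<close>-th derivative in the direction \<open>h\<close>, expanded into coordinate derivatives. Only the scalar
  coefficients depend on \<open>h\<close>.
\<close>
lemma fourier_integral_directional_power:
  fixes g :: "real^'d \<Rightarrow> complex"
  assumes \<Omega>: "compact \<Omega>" and g: "g \<in> spectra \<Omega>"
  shows "fourier_integral (\<lambda>\<omega>. (\<i> * of_real (\<omega> \<bullet> h)) ^ j * g \<omega>) x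
    = (\<Sum>p\<in>tuples j. of_real (\<Prod>l<j. h $ p l) * fourier_integral (\<lambda>\<omega>. freq_tuple j p \<omega> * g \<omega>) x)"
proof -
  have int: "integrable lborel (\<lambda>\<omega>. freq_tuple j p \<omega> * g \<omega> * iexp (\<omega> \<bullet> x))" for p
    by (intro integrable_iexp_mult spectra_integrable[OF \<Omega>] spectra_mult[OF \<Omega> g] freq_tuple_cont)
  have "fourier_integral (\<lambda>\<omega>. (\<i> * of_real (\<omega> \<bullet> h)) ^ j * g \<omega>) x
      = (LINT \<omega>|lborel. (\<Sum>p\<in>tuples j. of_real (\<Prod>l<j. h $ p l) * (freq_tuple j p \<omega> * g \<omega> * iexp (\<omega> \<bullet> x))))"
    unfolding fourier_integral_def inner_power_eq_tuples by (simp only: sum_distrib_right mult.assoc)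
  also have "\<dots> = (\<Sum>p\<in>tuples j. of_real (\<Prod>l<j. h $ p l) * fourier_integral (\<lambda>\<omega>. freq_tuple j p \<omega> * g \<omega>) x)"
    unfolding fourier_integral_def using int
    by (subst Bochner_Integration.integral_sum) (simp_all only: integrable_mult_right integral_mult_right_zero)
  finally show ?thesis .
qed

text \<open>
  By the Plancherel theorem the left-hand side is a multiple of \<open>\<integral> |\<omega>|\<^bsup>2j\<^esup> |g(\<omega>)|\<^sup>2\<close>, because the squared
  symbols sum to \<open>(\<omega>\<^sub>1\<^sup>2 + \<cdots> + \<omega>\<^sub>d\<^sup>2)\<^sup>j\<close>.
\<close>
lemma Bernstein_tuples:
  fixes g :: "real^'d \<Rightarrow> complex"
  assumes \<Omega>: "compact \<Omega>" and g: "g \<in> spectra \<Omega>"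
  shows "(\<Sum>p\<in>tuples j. (L2_norm (fourier_integral (\<lambda>\<omega>. freq_tuple j p \<omega> * g \<omega>)))\<^sup>2)
    \<le> (band_radius \<Omega>) ^ (2 * j) * (L2_norm (fourier_integral g))\<^sup>2"
proof -
  let ?c = "(2 * pi) ^ CARD('d)"
  have u: "(\<lambda>\<omega>. freq_tuple j p \<omega> * g \<omega>) \<in> spectra \<Omega>" for p
    by (intro spectra_mult[OF \<Omega> g] freq_tuple_cont)
  have norm_fourier_integral: "(L2_norm (fourier_integral v))\<^sup>2 = ?c * (LINT \<omega>|lborel. (cmod (v \<omega>))\<^sup>2)" if "v \<in> spectra \<Omega>" for v
    using Plancherel_norm[OF spectra_integrable[OF \<Omega> that] spectra_L2[OF that]]
    by (simp add: L2_norm_power2)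
  note intu = L2_D(2)[OF spectra_L2[OF u]]
  have pt: "(\<Sum>p\<in>tuples j. (cmod (freq_tuple j p \<omega> * g \<omega>))\<^sup>2) = (norm \<omega>) ^ (2 * j) * (cmod (g \<omega>))\<^sup>2" for \<omega>
    unfolding norm_power_eq_tuples sum_distrib_right
    by (intro sum.cong refl)
      (simp add: freq_tuple_def norm_mult power_mult_distrib flip: prod_norm abs_prod)
  have "(\<Sum>p\<in>tuples j. (L2_norm (fourier_integral (\<lambda>\<omega>. freq_tuple j p \<omega> * g \<omega>)))\<^sup>2)
      = ?c * (LINT \<omega>|lborel. (\<Sum>p\<in>tuples j. (cmod (freq_tuple j p \<omega> * g \<omega>))\<^sup>2))"
    unfolding norm_fourier_integral[OF u] sum_distrib_left[symmetric]
    by (subst Bochner_Integration.integral_sum) (use intu in auto)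
  also have "\<dots> \<le> ?c * (LINT \<omega>|lborel. (band_radius \<Omega>) ^ (2 * j) * (cmod (g \<omega>))\<^sup>2)"
  proof (intro mult_left_mono integral_mono)
    show "integrable lborel (\<lambda>\<omega>. \<Sum>p\<in>tuples j. (cmod (freq_tuple j p \<omega> * g \<omega>))\<^sup>2)"
      by (intro Bochner_Integration.integrable_sum intu)
    show "integrable lborel (\<lambda>\<omega>. (band_radius \<Omega>) ^ (2 * j) * (cmod (g \<omega>))\<^sup>2)"
      by (intro integrable_mult_right L2_D(2) spectra_L2[OF g])
    show "(\<Sum>p\<in>tuples j. (cmod (freq_tuple j p \<omega> * g \<omega>))\<^sup>2) \<le> (band_radius \<Omega>) ^ (2 * j) * (cmod (g \<omega>))\<^sup>2" for \<omega>
    proof (cases "\<omega> \<in> \<Omega>")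
      case True
      then show ?thesis unfolding pt
        by (intro mult_right_mono power_mono norm_le_band_radius[OF \<Omega>]) auto
    next
      case False
      then show ?thesis using g by (simp add: spectra_def)
    qed
  qed simp
  also have "\<dots> = (band_radius \<Omega>) ^ (2 * j) * (L2_norm (fourier_integral g))\<^sup>2"
    using norm_fourier_integral[OF g] by simp
  finally show ?thesis .
qed

lemma L2_set_sum_le: "L2_set (\<lambda>i. \<Sum>j\<in>J. f j i) F \<le> (\<Sum>j\<in>J. L2_set (f j) F)"
proof (induction J rule: infinite_finite_induct)
  case (insert j J)
  then show ?case
    using L2_set_triangle_ineq[of "f j" "\<lambda>i. \<Sum>j\<in>J. f j i" F] by simp
qed (auto simp: L2_set_def)

text \<open>
  The weights are put into the samples as square roots, so that the weighted sums become plain sums of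
  squares and the triangle inequality for \<^const>\<open>L2_set\<close> applies.
\<close>
definition sample :: "('n \<Rightarrow> nat^'d \<Rightarrow> real) \<Rightarrow> ('n \<Rightarrow> real^'d) \<Rightarrow> (real^'d \<Rightarrow> complex) \<Rightarrow> 'n \<times> (nat^'d) \<Rightarrow> complex" where
  "sample \<mu> y f = (\<lambda>(n, \<alpha>). of_real (sqrt (\<mu> n \<alpha>)) * multi_diff \<alpha> f (y n))"

text \<open>
  The core of the argument. The set \<open>F\<close> of samples is finite; the passage to all samples is left to the
  supremum that defines the infinite sums.
\<close>
lemma sample_perturbation:
  fixes f :: "real^'d \<Rightarrow> complex" and y y' :: "'n \<Rightarrow> real^'d"
  assumes \<Omega>: "compact \<Omega>" and f: "f \<in> bandlimited \<Omega>" and B: "0 \<le> B"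
    and bound: "\<And>f. f \<in> bandlimited \<Omega> \<Longrightarrow> (\<Sum>q\<in>F. (cmod (sample \<mu> y f q))\<^sup>2) \<le> B * (L2_norm f)\<^sup>2"
    and close: "\<And>q. q \<in> F \<Longrightarrow> norm (y' (fst q) - y (fst q)) \<le> r" and r: "0 \<le> r"
  shows "L2_set (\<lambda>q. cmod (sample \<mu> y' f q - sample \<mu> y f q)) F
    \<le> sqrt B * L2_norm f * (exp (band_radius \<Omega> * r) - 1)"
proof (cases "finite F")
  case False
  then show ?thesis
    using B r band_radius_nonneg[OF \<Omega>] by (simp add: L2_norm_nonneg)
next
  case fin: True
  obtain g where g: "g \<in> spectra \<Omega>" and f_eq: "f = fourier_integral g"
    using f unfolding bandlimited_eq[OF \<Omega>] by blast
  define m where "m = band_radius \<Omega>"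
  have m: "0 \<le> m" unfolding m_def by (rule band_radius_nonneg[OF \<Omega>])
  define h where "h q = y' (fst q) - y (fst q)" for q :: "'n \<times> (nat^'d)"
  define ga where "ga \<alpha> \<omega> = freq_power \<alpha> \<omega> * g \<omega>" for \<alpha> and \<omega> :: "real^'d"
  have ga: "ga \<alpha> \<in> spectra \<Omega>" for \<alpha>
    unfolding ga_def by (intro spectra_mult[OF \<Omega> g] freq_power_cont)
  define w where "w q = sqrt (\<mu> (fst q) (snd q))" for q
  \<comment> \<open>\<open>t j q\<close> is the weighted Taylor term of degree \<open>j\<close> at the sample \<open>q\<close>.\<close>
define t where "t j q = of_real (w q) *
      (fourier_integral (\<lambda>\<omega>. (\<i> * of_real (\<omega> \<bullet> h q)) ^ j * ga (snd q) \<omega>) (y (fst q)) / fact j)" for j q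
  have sums: "(\<lambda>j. t (Suc j) q) sums (sample \<mu> y' f q - sample \<mu> y f q)" for q
  proof -
    have "sample \<mu> y' f q - sample \<mu> y f q
        = of_real (w q) * (fourier_integral (ga (snd q)) (y (fst q) + h q) - fourier_integral (ga (snd q)) (y (fst q)))"
      by (simp add: sample_def case_prod_beta f_eq multi_diff_fourier_integral[OF \<Omega> g] ga_def[abs_def] w_def h_def algebra_simps)
    then show ?thesis
      unfolding t_def by (simp only: sums_mult fourier_integral_Taylor_sums[OF \<Omega> ga])
  qed
  have term_bound: "L2_set (\<lambda>q. cmod (t j q)) F \<le> sqrt B * L2_norm f * ((m * r) ^ j / fact j)" for j
  proof -
    let ?u = "\<lambda>p \<omega>. freq_tuple j p \<omega> * g \<omega>"
    have u: "?u p \<in> spectra \<Omega>" for p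
      by (intro spectra_mult[OF \<Omega> g] freq_tuple_cont)
    have md: "multi_diff \<alpha> (fourier_integral (?u p)) = fourier_integral (\<lambda>\<omega>. freq_tuple j p \<omega> * ga \<alpha> \<omega>)" for \<alpha> p
      unfolding multi_diff_fourier_integral[OF \<Omega> u] ga_def by (simp only: mult.left_commute)
    have t_eq: "fact j * t j q = (\<Sum>p\<in>tuples j. of_real (\<Prod>l<j. h q $ p l) * sample \<mu> y (fourier_integral (?u p)) q)" for q
    proof -
      have "fact j * t j q = of_real (w q) * (\<Sum>p\<in>tuples j. of_real (\<Prod>l<j. h q $ p l)
          * fourier_integral (\<lambda>\<omega>. freq_tuple j p \<omega> * ga (snd q) \<omega>) (y (fst q)))"
        unfolding t_def fourier_integral_directional_power[OF \<Omega> ga] by simp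
      also have "\<dots> = (\<Sum>p\<in>tuples j. of_real (\<Prod>l<j. h q $ p l) * sample \<mu> y (fourier_integral (?u p)) q)"
        unfolding sum_distrib_left
        by (intro sum.cong refl)
          (simp only: sample_def case_prod_beta md w_def mult.left_commute)
      finally show ?thesis .
    qed
    \<comment> \<open>Cauchy-Schwarz over the tuples removes the dependence of the coefficients on the sample, so that
  the sampling bound can then be applied to each function \<open>fourier_integral (?u p)\<close> separately.\<close>
have pt: "(fact j * cmod (t j q))\<^sup>2 \<le> r ^ (2 * j) * (\<Sum>p\<in>tuples j. (cmod (sample \<mu> y (fourier_integral (?u p)) q))\<^sup>2)"
      if q: "q \<in> F" for q
    proof -
      have "fact j * cmod (t j q) = cmod (\<Sum>p\<in>tuples j. of_real (\<Prod>l<j. h q $ p l) * sample \<mu> y (fourier_integral (?u p)) q)"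
        unfolding t_eq[symmetric] by (simp add: norm_mult)
      also have "\<dots> \<le> (\<Sum>p\<in>tuples j. \<bar>\<Prod>l<j. h q $ p l\<bar> * cmod (sample \<mu> y (fourier_integral (?u p)) q))"
        by (rule order_trans[OF norm_sum]) (simp only: norm_mult norm_of_real order_refl)
      finally have "(fact j * cmod (t j q))\<^sup>2
          \<le> (\<Sum>p\<in>tuples j. \<bar>\<Prod>l<j. h q $ p l\<bar> * cmod (sample \<mu> y (fourier_integral (?u p)) q))\<^sup>2"
        by (intro power_mono) auto
      also have "\<dots> \<le> (\<Sum>p\<in>tuples j. \<bar>\<Prod>l<j. h q $ p l\<bar>\<^sup>2) * (\<Sum>p\<in>tuples j. (cmod (sample \<mu> y (fourier_integral (?u p)) q))\<^sup>2)"
        by (rule Cauchy_Schwarz_ineq_sum)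
      also have "(\<Sum>p\<in>tuples j. \<bar>\<Prod>l<j. h q $ p l\<bar>\<^sup>2) = norm (h q) ^ (2 * j)"
        by (simp add: norm_power_eq_tuples)
      also have "norm (h q) ^ (2 * j) * (\<Sum>p\<in>tuples j. (cmod (sample \<mu> y (fourier_integral (?u p)) q))\<^sup>2)
          \<le> r ^ (2 * j) * (\<Sum>p\<in>tuples j. (cmod (sample \<mu> y (fourier_integral (?u p)) q))\<^sup>2)"
        using close[OF q] by (intro mult_right_mono power_mono sum_nonneg) (auto simp: h_def)
      finally show ?thesis .
    qed
    have "(fact j * L2_set (\<lambda>q. cmod (t j q)) F)\<^sup>2 = (\<Sum>q\<in>F. (fact j * cmod (t j q))\<^sup>2)"
      by (simp add: L2_set_def power_mult_distrib sum_nonneg sum_distrib_left)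
    also have "\<dots> \<le> (\<Sum>q\<in>F. r ^ (2 * j) * (\<Sum>p\<in>tuples j. (cmod (sample \<mu> y (fourier_integral (?u p)) q))\<^sup>2))"
      by (intro sum_mono pt)
    also have "\<dots> = r ^ (2 * j) * (\<Sum>p\<in>tuples j. \<Sum>q\<in>F. (cmod (sample \<mu> y (fourier_integral (?u p)) q))\<^sup>2)"
      unfolding sum_distrib_left[symmetric] by (subst sum.swap) (rule refl)
    also have "\<dots> \<le> r ^ (2 * j) * (\<Sum>p\<in>tuples j. B * (L2_norm (fourier_integral (?u p)))\<^sup>2)"
      using r u by (intro mult_left_mono sum_mono bound) (auto simp: bandlimited_eq[OF \<Omega>])
    also have "\<dots> \<le> r ^ (2 * j) * (B * (m ^ (2 * j) * (L2_norm f)\<^sup>2))"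
      unfolding sum_distrib_left[symmetric] f_eq m_def
      using r B by (intro mult_left_mono Bernstein_tuples[OF \<Omega> g]) auto
    also have "\<dots> = (sqrt B * L2_norm f * (m * r) ^ j)\<^sup>2"
    proof -
      have "((m * r) ^ j)\<^sup>2 = m ^ (2 * j) * r ^ (2 * j)"
        by (metis mult.commute power_mult power_mult_distrib)
      moreover have "(a * b * c)\<^sup>2 = a\<^sup>2 * b\<^sup>2 * c\<^sup>2" for a b c :: real
        by (simp add: power_mult_distrib)
      ultimately show ?thesis using B by (simp only: real_sqrt_pow2 mult_ac)
    qed
    finally have "fact j * L2_set (\<lambda>q. cmod (t j q)) F \<le> sqrt B * L2_norm f * (m * r) ^ j"
      by (rule power2_le_imp_le) (use B m r in \<open>simp add: L2_norm_nonneg\<close>)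
    then show ?thesis by (simp add: field_simps)
  qed
  have exp_sums: "(\<lambda>j. (m * r) ^ Suc j / fact (Suc j)) sums (exp (m * r) - 1)"
    using exp_converges[of "m * r"] by (subst sums_Suc_iff) (simp add: field_simps)
  have partial: "L2_set (\<lambda>q. cmod (\<Sum>j<N. t (Suc j) q)) F \<le> sqrt B * L2_norm f * (exp (m * r) - 1)" for N
  proof -
    have "L2_set (\<lambda>q. cmod (\<Sum>j<N. t (Suc j) q)) F \<le> L2_set (\<lambda>q. \<Sum>j<N. cmod (t (Suc j) q)) F"
      by (intro L2_set_mono norm_sum) auto
    also have "\<dots> \<le> (\<Sum>j<N. L2_set (\<lambda>q. cmod (t (Suc j) q)) F)" by (rule L2_set_sum_le)
    also have "\<dots> \<le> (\<Sum>j<N. sqrt B * L2_norm f * ((m * r) ^ Suc j / fact (Suc j)))"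
      by (intro sum_mono term_bound)
    also have "\<dots> = sqrt B * L2_norm f * (\<Sum>j<N. (m * r) ^ Suc j / fact (Suc j))"
      by (simp only: sum_distrib_left)
    also have "\<dots> \<le> sqrt B * L2_norm f * (exp (m * r) - 1)"
    proof (rule mult_left_mono)
      show "(\<Sum>j<N. (m * r) ^ Suc j / fact (Suc j)) \<le> exp (m * r) - 1"
        unfolding sums_unique[OF exp_sums]
        by (rule sum_le_suminf[OF sums_summable[OF exp_sums]]) (use m r in auto)
    qed (use B in \<open>simp add: L2_norm_nonneg\<close>)
    finally show ?thesis .
  qed
  have "(\<lambda>N. L2_set (\<lambda>q. cmod (\<Sum>j<N. t (Suc j) q)) F)
      \<longlonglongrightarrow> L2_set (\<lambda>q. cmod (sample \<mu> y' f q - sample \<mu> y f q)) F"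
    unfolding L2_set_def using sums unfolding sums_def by (intro tendsto_intros)
  then show ?thesis
    unfolding m_def[symmetric] using partial by (intro LIMSEQ_le_const2) auto
qed

section \<open>Sampling bounds and frames\<close>

lemma infsum_ennreal_le_iff:
  assumes "\<And>q. q \<in> J \<Longrightarrow> 0 \<le> e q" "0 \<le> C"
  shows "(\<Sum>\<^sub>\<infinity>q\<in>J. ennreal (e q)) \<le> ennreal C \<longleftrightarrow> (\<forall>F. finite F \<longrightarrow> F \<subseteq> J \<longrightarrow> (\<Sum>q\<in>F. e q) \<le> C)"
proof -
  have "(\<Sum>\<^sub>\<infinity>q\<in>J. ennreal (e q)) = (SUP F\<in>{F. finite F \<and> F \<subseteq> J}. \<Sum>q\<in>F. ennreal (e q))"
    by (intro nonneg_infsum_complete) simp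
  also have "\<dots> = (SUP F\<in>{F. finite F \<and> F \<subseteq> J}. ennreal (\<Sum>q\<in>F. e q))"
    using assms(1) by (intro SUP_cong refl sum_ennreal) blast
  finally show ?thesis
    using assms(2) by (auto simp: SUP_le_iff ennreal_le_iff)
qed

lemma infsum_sum_ennreal:
  fixes f :: "'a \<times> 'b \<Rightarrow> ennreal"
  assumes M: "finite M"
  shows "(\<Sum>\<^sub>\<infinity>n\<in>I. \<Sum>\<alpha>\<in>M. f (n, \<alpha>)) = (\<Sum>\<^sub>\<infinity>q\<in>I \<times> M. f q)"
proof -
  have L: "(\<Sum>\<^sub>\<infinity>n\<in>I. \<Sum>\<alpha>\<in>M. f (n, \<alpha>)) = (SUP G\<in>{G. finite G \<and> G \<subseteq> I}. \<Sum>n\<in>G. \<Sum>\<alpha>\<in>M. f (n, \<alpha>))"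
    by (intro nonneg_infsum_complete) simp
  have R: "(\<Sum>\<^sub>\<infinity>q\<in>I \<times> M. f q) = (SUP F\<in>{F. finite F \<and> F \<subseteq> I \<times> M}. \<Sum>q\<in>F. f q)"
    by (intro nonneg_infsum_complete) simp
  show ?thesis
    unfolding L R
  proof (rule antisym)
    show "(SUP G\<in>{G. finite G \<and> G \<subseteq> I}. \<Sum>n\<in>G. \<Sum>\<alpha>\<in>M. f (n, \<alpha>))
        \<le> (SUP F\<in>{F. finite F \<and> F \<subseteq> I \<times> M}. \<Sum>q\<in>F. f q)"
    proof (rule SUP_mono)
      fix G assume "G \<in> {G. finite G \<and> G \<subseteq> I}"
      then show "\<exists>F\<in>{F. finite F \<and> F \<subseteq> I \<times> M}. (\<Sum>n\<in>G. \<Sum>\<alpha>\<in>M. f (n, \<alpha>)) \<le> (\<Sum>q\<in>F. f q)"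
        using M by (intro bexI[of _ "G \<times> M"]) (auto simp: sum.cartesian_product)
    qed
    show "(SUP F\<in>{F. finite F \<and> F \<subseteq> I \<times> M}. \<Sum>q\<in>F. f q)
        \<le> (SUP G\<in>{G. finite G \<and> G \<subseteq> I}. \<Sum>n\<in>G. \<Sum>\<alpha>\<in>M. f (n, \<alpha>))"
    proof (rule SUP_mono)
      fix F assume F: "F \<in> {F. finite F \<and> F \<subseteq> I \<times> M}"
      have "(\<Sum>q\<in>F. f q) \<le> (\<Sum>q\<in>fst ` F \<times> M. f q)"
      proof (rule sum_mono2)
        show "F \<subseteq> fst ` F \<times> M" using F by force
      qed (use F M in auto)
      then show "\<exists>G\<in>{G. finite G \<and> G \<subseteq> I}. (\<Sum>q\<in>F. f q) \<le> (\<Sum>n\<in>G. \<Sum>\<alpha>\<in>M. f (n, \<alpha>))"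
        using F by (intro bexI[of _ "fst ` F"]) (auto simp: sum.cartesian_product)
    qed
  qed
qed

text \<open>
  The triangle inequality in \<open>\<ell>\<^sup>2\<close>, with the perturbation controlled on finite sets only.
\<close>
lemma infsum_square_perturbation:
  fixes v v' :: "'j \<Rightarrow> complex"
  assumes D: "\<And>F. finite F \<Longrightarrow> F \<subseteq> J \<Longrightarrow> L2_set (\<lambda>q. cmod (v' q - v q)) F \<le> D"
    and v: "(\<Sum>\<^sub>\<infinity>q\<in>J. ennreal ((cmod (v q))\<^sup>2)) \<le> ennreal (S\<^sup>2)" and S: "0 \<le> S"
  shows "(\<Sum>\<^sub>\<infinity>q\<in>J. ennreal ((cmod (v' q))\<^sup>2)) \<le> ennreal ((S + D)\<^sup>2)"
proof (subst infsum_ennreal_le_iff, simp_all, intro allI impI)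
  fix F assume F: "finite F" "F \<subseteq> J"
  have "(\<Sum>q\<in>F. (cmod (v q))\<^sup>2) \<le> S\<^sup>2"
    using v F by (subst (asm) infsum_ennreal_le_iff) auto
  then have vF: "L2_set (\<lambda>q. cmod (v q)) F \<le> S"
    using S unfolding L2_set_def by (intro real_le_lsqrt) (auto intro: sum_nonneg)
  have "L2_set (\<lambda>q. cmod (v' q)) F \<le> L2_set (\<lambda>q. cmod (v q) + cmod (v' q - v q)) F"
    by (intro L2_set_mono) (use norm_triangle_sub in auto)
  also have "\<dots> \<le> L2_set (\<lambda>q. cmod (v q)) F + L2_set (\<lambda>q. cmod (v' q - v q)) F"
    by (rule L2_set_triangle_ineq)
  also have "\<dots> \<le> S + D" using vF D[OF F] by linarith
  finally have "(L2_set (\<lambda>q. cmod (v' q)) F)\<^sup>2 \<le> (S + D)\<^sup>2" by (intro power_mono) auto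
  then show "(\<Sum>q\<in>F. (cmod (v' q))\<^sup>2) \<le> (S + D)\<^sup>2" by (simp add: L2_set_def sum_nonneg)
qed

lemma sampling_bounds_iff:
  assumes "\<And>n \<alpha>. n \<in> I \<Longrightarrow> \<alpha> \<in> multi_indices k \<Longrightarrow> 0 < \<mu> n \<alpha>"
  shows "sampling_bounds \<Omega> k I \<mu> x A B \<longleftrightarrow> 0 < A \<and> 0 < B \<and> (\<forall>f\<in>bandlimited \<Omega>.
      ennreal (A * (L2_norm f)\<^sup>2) \<le> (\<Sum>\<^sub>\<infinity>q\<in>I \<times> multi_indices k. ennreal ((cmod (sample \<mu> x f q))\<^sup>2)) \<and>
      (\<Sum>\<^sub>\<infinity>q\<in>I \<times> multi_indices k. ennreal ((cmod (sample \<mu> x f q))\<^sup>2)) \<le> ennreal (B * (L2_norm f)\<^sup>2))"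
proof -
  have "(\<Sum>\<^sub>\<infinity>n\<in>I. \<Sum>\<alpha>\<in>multi_indices k. ennreal (\<mu> n \<alpha> * (cmod (multi_diff \<alpha> f (x n)))\<^sup>2))
      = (\<Sum>\<^sub>\<infinity>q\<in>I \<times> multi_indices k. ennreal ((cmod (sample \<mu> x f q))\<^sup>2))" for f
    unfolding infsum_sum_ennreal[OF finite_multi_indices, symmetric]
    using assms
    by (intro infsum_cong sum.cong refl) (simp add: sample_def norm_mult power_mult_distrib less_imp_le)
  then show ?thesis by (simp add: sampling_bounds_def)
qed

text \<open>
  Translating a function modulates its spectrum, here the normalised indicator function of the band.
\<close>
lemma Phi_translate:
  fixes \<Omega> :: "(real^'d) set"
  shows "(\<lambda>z. Phi \<Omega> (z - y))
    = fourier_integral (\<lambda>\<omega>. (iexp (- (\<omega> \<bullet> y)) / of_real ((2 * pi) ^ CARD('d))) * indicator \<Omega> \<omega>)"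
proof
  fix z
  have "Phi \<Omega> (z - y) = (LINT \<omega>|lborel. (indicator \<Omega> \<omega> *\<^sub>R iexp (\<omega> \<bullet> (z - y))) / of_real ((2 * pi) ^ CARD('d)))"
    unfolding Phi_def set_lebesgue_integral_def by (rule integral_divide_zero[symmetric])
  also have "\<dots> = fourier_integral (\<lambda>\<omega>. (iexp (- (\<omega> \<bullet> y)) / of_real ((2 * pi) ^ CARD('d))) * indicator \<Omega> \<omega>) z"
    unfolding fourier_integral_def
  proof (intro Bochner_Integration.integral_cong refl)
    fix \<omega>
    have "iexp (\<omega> \<bullet> (z - y)) = iexp (- (\<omega> \<bullet> y)) * iexp (\<omega> \<bullet> z)"
      by (simp add: inner_diff_right algebra_simps flip: exp_add)
    then show "(indicator \<Omega> \<omega> *\<^sub>R iexp (\<omega> \<bullet> (z - y))) / of_real ((2 * pi) ^ CARD('d))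
        = (iexp (- (\<omega> \<bullet> y)) / of_real ((2 * pi) ^ CARD('d))) * indicator \<Omega> \<omega> * iexp (\<omega> \<bullet> z)"
      by (simp add: indicator_def)
  qed
  finally show "Phi \<Omega> (z - y) = fourier_integral (\<lambda>\<omega>. (iexp (- (\<omega> \<bullet> y)) / of_real ((2 * pi) ^ CARD('d))) * indicator \<Omega> \<omega>) z" .
qed

lemma cnj_freq_power: "cnj (freq_power \<alpha> \<omega>) = (- 1) ^ (\<Sum>i\<in>UNIV. \<alpha> $ i) * freq_power \<alpha> \<omega>"
proof -
  have "cnj ((\<i> * of_real (\<omega> $ i)) ^ (\<alpha> $ i)) = (- 1) ^ (\<alpha> $ i) * (\<i> * of_real (\<omega> $ i)) ^ (\<alpha> $ i)" for i
    by (simp add: power_mult_distrib power_minus[of "\<i>"])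
  then show ?thesis by (simp add: freq_power_def prod.distrib power_sum del: complex_cnj_power)
qed

text \<open>
  The Plancherel theorem turns the inner product into the integral of \<open>g\<close> against the conjugate of
  \<open>(i\<omega>)\<^sup>\<alpha> e\<^bsup>-i\<omega>\<cdot>x\<^sub>n\<^esup>\<close>, that is, up to the sign \<open>(-1)\<^bsup>|\<alpha>|\<^esup>\<close> into \<open>D\<^sup>\<alpha> f\<close> at \<open>x\<^sub>n\<close>.
\<close>
lemma frame_family_in_bandlimited:
  fixes \<Omega> :: "(real^'d) set"
  assumes \<Omega>: "compact \<Omega>"
  shows "frame_family \<Omega> \<mu> x q \<in> bandlimited \<Omega>"
    and "f \<in> bandlimited \<Omega> \<Longrightarrow> cmod (L2_inner f (frame_family \<Omega> \<mu> x q)) = cmod (sample \<mu> x f q)"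
proof -
  obtain n \<alpha> where q: "q = (n, \<alpha>)" by (cases q)
  define c :: real where "c = (2 * pi) ^ CARD('d)"
  have c: "c \<noteq> 0" by (simp add: c_def)
  define u where "u \<omega> = (iexp (- (\<omega> \<bullet> x n)) / of_real c) * indicator \<Omega> \<omega>" for \<omega>
  have ind: "indicator \<Omega> \<in> spectra \<Omega>"
  proof -
    obtain R where "\<And>\<omega>. \<omega> \<in> \<Omega> \<Longrightarrow> norm \<omega> \<le> R"
      using compact_imp_bounded[OF \<Omega>] by (auto simp: bounded_iff)
    then have "(indicator \<Omega> :: real^'d \<Rightarrow> complex) \<in> L2"
      using borel_compact[OF \<Omega>]
      by (intro L2_of_bounded[of _ 1 R]) (auto simp: indicator_def)
    then show ?thesis by (simp add: spectra_def)
  qed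
  have u: "u \<in> spectra \<Omega>"
    unfolding u_def[abs_def] by (intro spectra_mult[OF \<Omega> ind] continuous_intros) (use c in auto)
  have Phi_eq: "(\<lambda>z. Phi \<Omega> (z - x n)) = fourier_integral u"
    unfolding Phi_translate u_def[abs_def] c_def ..
  define v where "v \<omega> = of_real (sqrt (\<mu> n \<alpha>)) * (freq_power \<alpha> \<omega> * u \<omega>)" for \<omega>
  have v: "v \<in> spectra \<Omega>"
    unfolding v_def[abs_def] by (intro spectra_mult[OF \<Omega>] u freq_power_cont continuous_intros)
  have fam: "frame_family \<Omega> \<mu> x q = fourier_integral v"
  proof
    fix z
    have "frame_family \<Omega> \<mu> x q z = of_real (sqrt (\<mu> n \<alpha>)) * fourier_integral (\<lambda>\<omega>. freq_power \<alpha> \<omega> * u \<omega>) z"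
      by (simp add: q frame_family_def Phi_eq multi_diff_fourier_integral[OF \<Omega> u])
    also have "\<dots> = fourier_integral v z"
      unfolding fourier_integral_def v_def mult.assoc[of "of_real (sqrt (\<mu> n \<alpha>))"] by (rule integral_mult_right_zero[symmetric])
    finally show "frame_family \<Omega> \<mu> x q z = fourier_integral v z" .
  qed
  show "frame_family \<Omega> \<mu> x q \<in> bandlimited \<Omega>"
    unfolding fam bandlimited_eq[OF \<Omega>] using v by blast
  assume "f \<in> bandlimited \<Omega>"
  then obtain g where g: "g \<in> spectra \<Omega>" "f = fourier_integral g" unfolding bandlimited_eq[OF \<Omega>] by blast
  let ?s = "of_real (sqrt (\<mu> n \<alpha>)) * (- 1) ^ (\<Sum>i\<in>UNIV. \<alpha> $ i) :: complex"
  have pt: "of_real c * (g \<omega> * cnj (v \<omega>)) = ?s * (freq_power \<alpha> \<omega> * g \<omega> * iexp (\<omega> \<bullet> x n))" for \<omega>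
  proof (cases "\<omega> \<in> \<Omega>")
    case True
    then have "cnj (u \<omega>) = iexp (\<omega> \<bullet> x n) / of_real c"
      by (simp add: u_def exp_cnj)
    then show ?thesis using c by (simp add: v_def cnj_freq_power)
  next
    case False
    then show ?thesis using g(1) by (simp add: spectra_def)
  qed
  have "L2_inner f (frame_family \<Omega> \<mu> x q) = of_real c * L2_inner g v"
    unfolding fam g(2) c_def
    by (intro Plancherel spectra_integrable[OF \<Omega>] spectra_L2[of _ \<Omega>] g v)
  also have "\<dots> = (LINT \<omega>|lborel. ?s * (freq_power \<alpha> \<omega> * g \<omega> * iexp (\<omega> \<bullet> x n)))"
    unfolding L2_inner_def pt[symmetric] by (rule integral_mult_right_zero[symmetric])
  also have "\<dots> = ?s * multi_diff \<alpha> f (x n)"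
    unfolding g(2) multi_diff_fourier_integral[OF \<Omega> g(1)] fourier_integral_def by (rule integral_mult_right_zero)
  finally show "cmod (L2_inner f (frame_family \<Omega> \<mu> x q)) = cmod (sample \<mu> x f q)"
    by (simp add: q sample_def norm_mult norm_power)
qed

lemma is_frame_iff_sampling_bounds:
  fixes \<Omega> :: "(real^'d) set"
  assumes \<Omega>: "compact \<Omega>" and \<mu>: "\<And>n \<alpha>. n \<in> I \<Longrightarrow> \<alpha> \<in> multi_indices k \<Longrightarrow> 0 < \<mu> n \<alpha>"
  shows "is_frame (bandlimited \<Omega>) (I \<times> multi_indices k) (frame_family \<Omega> \<mu> x) A B
    \<longleftrightarrow> sampling_bounds \<Omega> k I \<mu> x A B"
  by (simp add: is_frame_def sampling_bounds_iff[OF \<mu>] frame_family_in_bandlimited[OF \<Omega>])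

text \<open>
  Adding the perturbation to the upper bound \<open>\<surd>B \<parallel>f\<parallel>\<close> gives the new upper bound. For the lower bound
  the roles of the points are exchanged: if the samples at \<open>x'\<close> were too small, adding the same
  perturbation to them would bring the samples at \<open>x\<close> below \<open>\<surd>A \<parallel>f\<parallel>\<close>.
\<close>
theorem sampling_bounds_perturbation:
  fixes \<Omega> :: "(real^'d) set" and x x' :: "'n \<Rightarrow> real^'d"
  assumes \<Omega>: "compact \<Omega>" and \<mu>: "\<And>n \<alpha>. n \<in> I \<Longrightarrow> \<alpha> \<in> multi_indices k \<Longrightarrow> 0 < \<mu> n \<alpha>"
    and close: "\<And>n. n \<in> I \<Longrightarrow> norm (x' n - x n) \<le> r" and r: "0 \<le> r"
    and small: "sqrt B * (exp (band_radius \<Omega> * r) - 1) < sqrt A"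
    and bounds: "sampling_bounds \<Omega> k I \<mu> x A B"
  shows "sampling_bounds \<Omega> k I \<mu> x' ((sqrt A - sqrt B * (exp (band_radius \<Omega> * r) - 1))\<^sup>2)
    (B * exp (2 * (band_radius \<Omega> * r)))"
proof -
  define E where "E y f = (\<Sum>\<^sub>\<infinity>q\<in>I \<times> multi_indices k. ennreal ((cmod (sample \<mu> y f q))\<^sup>2))"
    for y and f :: "real^'d \<Rightarrow> complex"
  define \<delta> where "\<delta> = exp (band_radius \<Omega> * r) - 1"
  have bounds_iff: "sampling_bounds \<Omega> k I \<mu> y A B \<longleftrightarrow> 0 < A \<and> 0 < B \<and> (\<forall>f\<in>bandlimited \<Omega>.
      ennreal (A * (L2_norm f)\<^sup>2) \<le> E y f \<and> E y f \<le> ennreal (B * (L2_norm f)\<^sup>2))" for y A B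
    unfolding E_def by (rule sampling_bounds_iff) (rule \<mu>)
  have AB: "0 < A" "0 < B" and lower: "\<And>f. f \<in> bandlimited \<Omega> \<Longrightarrow> ennreal (A * (L2_norm f)\<^sup>2) \<le> E x f"
    and upper: "\<And>f. f \<in> bandlimited \<Omega> \<Longrightarrow> E x f \<le> ennreal (B * (L2_norm f)\<^sup>2)"
    using bounds by (auto simp: bounds_iff)
  have finite_bound: "(\<Sum>q\<in>F. (cmod (sample \<mu> x f q))\<^sup>2) \<le> B * (L2_norm f)\<^sup>2"
    if "f \<in> bandlimited \<Omega>" "finite F" "F \<subseteq> I \<times> multi_indices k" for f F
    using upper[OF that(1)] that(2,3) AB unfolding E_def
    by (subst (asm) infsum_ennreal_le_iff) auto
  have pert: "L2_set (\<lambda>q. cmod (sample \<mu> x' f q - sample \<mu> x f q)) F \<le> sqrt B * L2_norm f * \<delta>"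
    if "f \<in> bandlimited \<Omega>" "finite F" "F \<subseteq> I \<times> multi_indices k" for f F
    unfolding \<delta>_def
  proof (rule sample_perturbation[OF \<Omega> that(1)])
    show "norm (x' (fst q) - x (fst q)) \<le> r" if "q \<in> F" for q
      using that \<open>F \<subseteq> I \<times> multi_indices k\<close> by (intro close) auto
  qed (use AB r finite_bound that(2,3) in auto)
  have pert': "L2_set (\<lambda>q. cmod (sample \<mu> x f q - sample \<mu> x' f q)) F \<le> sqrt B * L2_norm f * \<delta>"
    if "f \<in> bandlimited \<Omega>" "finite F" "F \<subseteq> I \<times> multi_indices k" for f F
    using pert[OF that] by (simp add: norm_minus_commute)
  have up: "E x' f \<le> ennreal (B * exp (2 * (band_radius \<Omega> * r)) * (L2_norm f)\<^sup>2)"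
    if f: "f \<in> bandlimited \<Omega>" for f
  proof -
    have "E x' f \<le> ennreal ((sqrt B * L2_norm f + sqrt B * L2_norm f * \<delta>)\<^sup>2)"
      unfolding E_def
      by (rule infsum_square_perturbation[OF pert[OF f]])
        (use upper[OF f] AB in \<open>simp_all add: E_def power_mult_distrib L2_norm_nonneg\<close>)
    also have "sqrt B * L2_norm f + sqrt B * L2_norm f * \<delta> = sqrt B * L2_norm f * exp (band_radius \<Omega> * r)"
      by (simp add: \<delta>_def algebra_simps)
    also have "(sqrt B * L2_norm f * exp (band_radius \<Omega> * r))\<^sup>2
        = B * exp (2 * (band_radius \<Omega> * r)) * (L2_norm f)\<^sup>2"
      using AB by (simp add: power_mult_distrib exp_double)
    finally show ?thesis .
  qed
  have low: "ennreal ((sqrt A - sqrt B * \<delta>)\<^sup>2 * (L2_norm f)\<^sup>2) \<le> E x' f"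
    if f: "f \<in> bandlimited \<Omega>" for f
  proof (rule ccontr)
    assume "\<not> ?thesis"
    then have less: "E x' f < ennreal (((sqrt A - sqrt B * \<delta>) * L2_norm f)\<^sup>2)"
      by (simp add: power_mult_distrib)
    define S where "S = sqrt (enn2real (E x' f))"
    have S: "0 \<le> S" by (simp add: S_def)
    have "E x' f < top" using less by (rule order_less_trans) simp
    then have E_eq: "E x' f = ennreal (S\<^sup>2)" by (simp add: S_def)
    then have "S\<^sup>2 < ((sqrt A - sqrt B * \<delta>) * L2_norm f)\<^sup>2"
      using less by (simp add: ennreal_less_iff)
    then have "S < (sqrt A - sqrt B * \<delta>) * L2_norm f"
      by (rule power2_less_imp_less) (use small in \<open>simp add: \<delta>_def L2_norm_nonneg\<close>)
    then have lt: "S + sqrt B * L2_norm f * \<delta> < sqrt A * L2_norm f" by (simp add: algebra_simps)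
    have "0 \<le> \<delta>" using r band_radius_nonneg[OF \<Omega>] by (simp add: \<delta>_def)
    then have nn: "0 \<le> S + sqrt B * L2_norm f * \<delta>"
      using S AB by (simp add: L2_norm_nonneg)
    have "ennreal (A * (L2_norm f)\<^sup>2) \<le> E x f" by (rule lower[OF f])
    also have "\<dots> \<le> ennreal ((S + sqrt B * L2_norm f * \<delta>)\<^sup>2)"
      unfolding E_def
      by (rule infsum_square_perturbation[OF pert'[OF f] _ S]) (simp_all flip: E_def E_eq)
    also have "\<dots> < ennreal ((sqrt A * L2_norm f)\<^sup>2)"
      using lt nn by (intro ennreal_lessI power_strict_mono) auto
    finally show False using AB by (simp add: power_mult_distrib)
  qed
  show ?thesis
    unfolding bounds_iff \<delta>_def[symmetric]
    using up low AB small by (simp add: \<delta>_def)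
qed

theorem theorem3p13:
  fixes \<Omega> :: "(real^'d::finite) set"
    and k :: nat
    and nrm :: "real^'d \<Rightarrow> real"
    and I :: "'n set"
    and x x' :: "'n \<Rightarrow> real^'d"
    and \<mu> :: "'n \<Rightarrow> nat^'d \<Rightarrow> real"
    and A B :: real
    and \<epsilon> :: ennreal
  assumes "compact \<Omega>"
    and "is_norm nrm"
    and "countable I"
    and "\<And>n \<alpha>. n \<in> I \<Longrightarrow> \<alpha> \<in> multi_indices k \<Longrightarrow> 0 < \<mu> n \<alpha>"
    and "0 < A" and "0 < B"
    and "\<epsilon> = (SUP n\<in>I. ennreal (nrm (x' n - x n)))"
    and "\<epsilon> < ennreal (ln (1 + sqrt (A / B))) / ennreal (band_radius \<Omega> * norm_const nrm)"
  shows "\<exists>A' B'.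
      0 < A' \<and> 0 < B' \<and>
      (sqrt A - sqrt B * (exp (band_radius \<Omega> * norm_const nrm * enn2real \<epsilon>) - 1))\<^sup>2 \<le> A' \<and>
      B' \<le> B * exp (2 * band_radius \<Omega> * norm_const nrm * enn2real \<epsilon>) \<and>
      (sampling_bounds \<Omega> k I \<mu> x A B \<longrightarrow> sampling_bounds \<Omega> k I \<mu> x' A' B') \<and>
      (is_frame (bandlimited \<Omega>) (I \<times> multi_indices k) (frame_family \<Omega> \<mu> x) A B \<longrightarrow>
       is_frame (bandlimited \<Omega>) (I \<times> multi_indices k) (frame_family \<Omega> \<mu> x') A' B')"
proof -
  define m where "m = band_radius \<Omega>"
  define b where "b = norm_const nrm"
  define e where "e = enn2real \<epsilon>"
  have m: "0 \<le> m" unfolding m_def by (rule band_radius_nonneg[OF assms(1)])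
  have b: "0 < b" unfolding b_def by (rule norm_const(1)[OF assms(2)])
  have "\<epsilon> < top" using assms(8) top.not_eq_extremum by fastforce
  then have \<epsilon>: "\<epsilon> = ennreal e" by (simp add: e_def)
  have e: "0 \<le> e" by (simp add: e_def)
  have ln_pos: "0 < ln (1 + sqrt (A / B))" using assms(5,6) by (intro ln_gt_zero) simp
  \<comment> \<open>If \<open>m b = 0\<close>, the bound on \<open>\<epsilon>\<close> is infinite, but then the product on the left vanishes.\<close>
have "m * b * e < ln (1 + sqrt (A / B))"
  proof (cases "m * b = 0")
    case True
    then show ?thesis unfolding True using ln_pos by simp
  next
    case False
    then have mb: "0 < m * b" using m b by (simp add: order_less_le)
    have "ennreal e < ennreal (ln (1 + sqrt (A / B)) / (m * b))"
      using assms(8) ln_pos mb unfolding \<epsilon> m_def[symmetric] b_def[symmetric] by (simp add: divide_ennreal)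
    then show ?thesis using e mb by (simp add: ennreal_less_iff field_simps)
  qed
  then have "exp (m * b * e) < 1 + sqrt (A / B)"
    using assms(5,6) by (metis add_pos_nonneg exp_less_cancel_iff exp_ln real_sqrt_ge_zero divide_nonneg_nonneg less_imp_le zero_less_one)
  then have "sqrt B * (exp (m * b * e) - 1) < sqrt B * sqrt (A / B)"
    using assms(6) by (intro mult_strict_left_mono) auto
  then have small: "sqrt B * (exp (m * (b * e)) - 1) < sqrt A"
    using assms(6) by (simp add: real_sqrt_divide mult.assoc)
  have close: "norm (x' n - x n) \<le> b * e" if "n \<in> I" for n
  proof -
    have "ennreal (nrm (x' n - x n)) \<le> ennreal e"
      unfolding \<epsilon>[symmetric] assms(7) using that by (rule SUP_upper)
    then have "nrm (x' n - x n) \<le> e" using e by (simp add: ennreal_le_iff)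
    then have "b * nrm (x' n - x n) \<le> b * e" using b by simp
    then show ?thesis using norm_const(2)[OF assms(2), of "x' n - x n"] by (simp add: b_def)
  qed
  let ?A' = "(sqrt A - sqrt B * (exp (m * (b * e)) - 1))\<^sup>2"
  let ?B' = "B * exp (2 * (m * (b * e)))"
  have main: "sampling_bounds \<Omega> k I \<mu> x A B \<longrightarrow> sampling_bounds \<Omega> k I \<mu> x' ?A' ?B'"
    unfolding m_def using b e small
    by (intro impI sampling_bounds_perturbation[OF assms(1,4) close]) (auto simp: m_def)
  show ?thesis
  proof (intro exI conjI)
    show "0 < ?A'" using small by simp
    show "0 < ?B'" using assms(6) by simp
  qed (use main in \<open>simp_all add: is_frame_iff_sampling_bounds[OF assms(1,4)] m_def b_def e_def mult.assoc\<close>)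
qed

end
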